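(* Let $n \in \mathbb{N}$ and let $D = D_1 \times \dots \times D_n$ be the direct product of strongly primary (commutative) monoids $D_1, \dots, D_n$, which are not half-factorial. \begin{enumerate} \item For every finite nonempty set $L \subset \mathbb{N}$, there is a $y_L \in \mathbb{N}_0$ such that $y + L \notin \mathcal{L}(D)$ for any $y \ge y_L$. \item We have $\mathcal{L}(D) \ne \mathcal{L}(G_0)$ for any subset $G_0$ of any abelian group, and hence $D$ is not a transfer Krull monoid. If $D_1, \dots, D_n$ are locally tame, then $D$ satisfies the Structure Theorem for Sets of Lengths. \end{enumerate}
   Context: $\mathbb{N}$ is the set of positive integers, $\mathbb{N}_0 = \mathbb{N} \cup \{0\}$, and $[a,b] = \{x \in \mathbb{Z} \mid a \le x \le b\}$; $y + L = \{y + l \mid l \in L\}$. A monoid is a commutative cancellative semigroup with unit element, written multiplicatively; $H^\times$ is the group of units of $H$, and $H_{\mathrm{red}} = H/H^\times$. An atom is a nonunit $a$ such that $a = uv$ implies $u \in H^\times$ or $v \in H^\times$; $\mathcal{A}(H)$ is the set of atoms; $H$ is atomic if every nonunit is a finite product of atoms. For a nonunit $a$, $\mathsf{L}(a)$ is the set of $k \in \mathbb{N}$ such that $a$ is a product of $k$ atoms, and $\mathsf{L}(a) = \{0\}$ for $a \in H^\times$. $\mathcal{L}(H) = \{\mathsf{L}(a) \mid a \in H\}$. $H$ is half-factorial if $|L| = 1$ for all $L \in \mathcal{L}(H)$. $H$ is strongly primary if $\mathfrak{m} = H \setminus H^\times \ne \emptyset$ and for every $a \in \mathfrak{m}$ there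 is an $n \in \mathbb{N}$ with $\mathfrak{m}^n \subset aH$, where $\mathfrak m^n$ is the set of products of $n$ elements of $\mathfrak m$. (Strongly primary monoids are atomic with finite sets of lengths.) Locally tame: let $H$ be atomic and let $\mathsf{Z}(H)$ be the free abelian monoid with basis $\mathcal{A}(H_{\mathrm{red}})$; for $a \in H$ let $\mathsf{Z}(a) \subset \mathsf{Z}(H)$ be the set of formal products whose value in $H_{\mathrm{red}}$ is $aH^\times$. For $z, z' \in \mathsf{Z}(H)$ with $w = \gcd(z,z')$, put $\mathsf{d}(z,z') = \max\{|w^{-1}z|, |w^{-1}z'|\}$, where $|\cdot|$ is the length. For $u \in \mathcal{A}(H_{\mathrm{red}})$, let $\mathsf{t}(H,u)$ be the smallest $N \in \mathbb{N}_0 \cup \{\infty\}$ such that for all $a \in H$ with $\mathsf{Z}(a) \cap u\mathsf{Z}(H) \ne \emptyset$ and all $z \in \mathsf{Z}(a)$ there is $z' \in \mathsf{Z}(a) \cap u\mathsf{Z}(H)$ with $\mathsf{d}(z,z') \le N$. $H$ is locally tame if $\mathsf{t}(H,u) < \infty$ for all $u \in \mathcal{A}(H_{\mathrm{red}})$. Structure Theorem: let $d \in \mathbb{N}$, $M \in \mathbb{N}_0$ and $\{0,d\} \subset \mathcal{D} \subset [0,d]$. A set $L \subset \mathbb{Z}$ is an almost arithmetical multiprogression (AAMP) with difference $d$, period $\mathcal{D}$ and bound $M$ if $L = y + (L' \cup L^* \cup L'') \subset y + \mathcal{D} + d\mathbb{Z}$ for some $y \in \mathbb{Z}$, where $L^*$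 is finite nonempty with $\min L^* = 0$ and $L^* = (\mathcal{D} + d\mathbb{Z}) \cap [0, \max L^*]$, $L' \subset [-M,-1]$ and $L'' \subset \max L^* + [1,M]$. The monoid $H$ satisfies the Structure Theorem for Sets of Lengths if $H$ is atomic and there exist $M \in \mathbb{N}_0$ and a finite nonempty set $\Delta \subset \mathbb{N}$ such that every $L \in \mathcal{L}(H)$ is an AAMP with some difference $d \in \Delta$ (and some period) and bound $M$. Zero-sum sequences: for a subset $G_0$ of an additive abelian group, $\mathcal{F}(G_0)$ is the (multiplicatively written) free abelian monoid with basis $G_0$, $\mathcal{B}(G_0) = \{g_1 \cdots g_\ell \in \mathcal{F}(G_0) \mid g_1 + \dots + g_\ell = 0\}$, and $\mathcal{L}(G_0) = \mathcal{L}(\mathcal{B}(G_0))$. A monoid homomorphism $\theta \colon H \to \mathcal{B}(G_0)$ is a weak transfer homomorphism if it is surjective, $\theta^{-1}(1) = H^\times$, and whenever $a \in H$, $n \in \mathbb{N}$, $v_1, \dots, v_n \in \mathcal{A}(\mathcal{B}(G_0))$ with $\theta(a) = v_1 \cdots v_n$, there exist $u_1, \dots, u_n \in \mathcal{A}(H)$ and a permutation $\tau$ of $[1,n]$ with $a = u_1 \cdots u_n$ and $\theta(u_i) = v_{\tau(i)}$ for all $i$. $H$ is a transfer Krull monoid if such a $\theta$ exists for some subset $G_0$ of an abelian group. *)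

theory Defs
  imports
    "HOL-Algebra.Divisibility"
    "HOL-Algebra.Product_Groups"
    "HOL-Library.Extended_Nat"
    "HOL-Combinatorics.Permutations"
begin

text \<open>
  A monoid in the sense of the theory of factorizations (commutative, cancellative, with unit
  element) is a \<^locale>\<open>comm_monoid_cancel\<close>.
\<close>

definition nonunits :: "('a, 'm) monoid_scheme \<Rightarrow> 'a set" where
  "nonunits H = carrier H - Units H"

definition atoms :: "('a, 'm) monoid_scheme \<Rightarrow> 'a set" where
  "atoms H = {a \<in> carrier H. irreducible H a}"

text \<open>
  The library defines \<^const>\<open>irreducible\<close> through proper divisors; in a cancellative commutative
  monoid this is the usual condition on products.
\<close>

lemma (in comm_monoid_cancel) atoms_iff:
  "a \<in> atoms G \<longleftrightarrow> a \<in> nonunits G \<and>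
     (\<forall>u\<in>carrier G. \<forall>v\<in>carrier G. a = u \<otimes> v \<longrightarrow> u \<in> Units G \<or> v \<in> Units G)"
proof
  assume a: "a \<in> atoms G"
  then have c: "a \<in> carrier G" and i: "irreducible G a"
    by (auto simp: atoms_def)
  from i have "a \<notin> Units G"
    by (simp add: irreducible_def)
  moreover have "u \<in> Units G \<or> v \<in> Units G"
    if "u \<in> carrier G" "v \<in> carrier G" "a = u \<otimes> v" for u v
    using i that by (auto elim!: irreducible_prodE)
  ultimately show "a \<in> nonunits G \<and>
     (\<forall>u\<in>carrier G. \<forall>v\<in>carrier G. a = u \<otimes> v \<longrightarrow> u \<in> Units G \<or> v \<in> Units G)"
    using c by (auto simp: nonunits_def)
next
  assume r: "a \<in> nonunits G \<and>
     (\<forall>u\<in>carrier G. \<forall>v\<in>carrier G. a = u \<otimes> v \<longrightarrow> u \<in> Units G \<or> v \<in> Units G)"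
  then have c: "a \<in> carrier G" and n: "a \<notin> Units G"
    by (auto simp: nonunits_def)
  have "b \<in> Units G" if b: "b \<in> carrier G" and p: "properfactor G b a" for b
  proof -
    obtain v where v: "v \<in> carrier G" and av: "a = b \<otimes> v"
      using p by (auto simp: properfactor_def factor_def)
    have "v \<notin> Units G"
    proof
      assume "v \<in> Units G"
      then have "b = a \<otimes> inv v"
        using av b by (metis Units_closed Units_inv_closed Units_r_inv m_assoc r_one)
      then have "a divides b"
        using \<open>v \<in> Units G\<close> by (auto simp: factor_def)
      with p show False
        by (simp add: properfactor_def)
    qed
    with r b v av show ?thesis by blast
  qed
  then show "a \<in> atoms G"
    using c n by (auto simp: atoms_def irreducible_def)
qed

definition list_prod :: "('a, 'm) monoid_scheme \<Rightarrow> 'a list \<Rightarrow> 'a" where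
  "list_prod H xs = foldr (\<otimes>\<^bsub>H\<^esub>) xs \<one>\<^bsub>H\<^esub>"

definition atomic :: "('a, 'm) monoid_scheme \<Rightarrow> bool" where
  "atomic H \<longleftrightarrow> (\<forall>a\<in>nonunits H. \<exists>us. set us \<subseteq> atoms H \<and> list_prod H us = a)"

definition set_of_lengths :: "('a, 'm) monoid_scheme \<Rightarrow> 'a \<Rightarrow> nat set" where
  "set_of_lengths H a =
     (if a \<in> Units H then {0}
      else {k. 0 < k \<and> (\<exists>us. length us = k \<and> set us \<subseteq> atoms H \<and> list_prod H us = a)})"

definition system_of_lengths :: "('a, 'm) monoid_scheme \<Rightarrow> nat set set" where
  "system_of_lengths H = set_of_lengths H ` carrier H"

definition half_factorial :: "('a, 'm) monoid_scheme \<Rightarrow> bool" where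
  "half_factorial H \<longleftrightarrow> (\<forall>L\<in>system_of_lengths H. card L = 1)"

definition set_power :: "('a, 'm) monoid_scheme \<Rightarrow> 'a set \<Rightarrow> nat \<Rightarrow> 'a set" where
  "set_power H S n = {list_prod H xs | xs. length xs = n \<and> set xs \<subseteq> S}"

definition strongly_primary :: "('a, 'm) monoid_scheme \<Rightarrow> bool" where
  "strongly_primary H \<longleftrightarrow>
     comm_monoid_cancel H \<and> nonunits H \<noteq> {} \<and>
     (\<forall>a\<in>nonunits H. \<exists>n>0. set_power H (nonunits H) n \<subseteq> a <#\<^bsub>H\<^esub> carrier H)"

definition free_abelian_monoid :: "'b set \<Rightarrow> 'b multiset monoid" where
  "free_abelian_monoid B = \<lparr>carrier = {z. set_mset z \<subseteq> B}, mult = (+), one = {#}\<rparr>"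

text \<open>
  The quotient construction of \<^theory>\<open>HOL-Algebra.Coset\<close> makes sense for monoids: the elements
  are the classes of \<open>a\<close> modulo units, and set multiplication multiplies representatives.
\<close>

definition reduced :: "('a, 'm) monoid_scheme \<Rightarrow> 'a set monoid" where
  "reduced H = H Mod (Units H)"

definition factorization_monoid :: "('a, 'm) monoid_scheme \<Rightarrow> 'a set multiset monoid" where
  "factorization_monoid H = free_abelian_monoid (atoms (reduced H))"

definition factorizations :: "('a, 'm) monoid_scheme \<Rightarrow> 'a \<Rightarrow> 'a set multiset set" where
  "factorizations H a =
     {mset us | us. mset us \<in> carrier (factorization_monoid H) \<and>
                    list_prod (reduced H) us = Units H #>\<^bsub>H\<^esub> a}"

text \<open>In a free abelian monoid, written as multisets, the gcd is the intersection.\<close>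

definition fact_dist :: "'b multiset \<Rightarrow> 'b multiset \<Rightarrow> nat" where
  "fact_dist z z' = (let w = z \<inter># z' in max (size (z - w)) (size (z' - w)))"

definition local_tame_degree :: "('a, 'm) monoid_scheme \<Rightarrow> 'a set \<Rightarrow> enat" where
  "local_tame_degree H u =
     (LEAST N. \<forall>a\<in>carrier H.
        factorizations H a \<inter> add_mset u ` carrier (factorization_monoid H) \<noteq> {} \<longrightarrow>
        (\<forall>z\<in>factorizations H a.
           \<exists>z'\<in>factorizations H a \<inter> add_mset u ` carrier (factorization_monoid H).
             enat (fact_dist z z') \<le> N))"

definition locally_tame :: "('a, 'm) monoid_scheme \<Rightarrow> bool" where
  "locally_tame H \<longleftrightarrow>
     atomic H \<and> (\<forall>u\<in>atoms (reduced H). local_tame_degree H u < \<infinity>)"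

text \<open>The set \<open>P + d\<int>\<close>.\<close>

definition periodic_set :: "nat \<Rightarrow> int set \<Rightarrow> int set" where
  "periodic_set d P = {p + int d * k | p k. p \<in> P}"

definition is_AAMP :: "nat \<Rightarrow> int set \<Rightarrow> nat \<Rightarrow> int set \<Rightarrow> bool" where
  "is_AAMP d P M L \<longleftrightarrow>
     0 < d \<and> {0, int d} \<subseteq> P \<and> P \<subseteq> {0..int d} \<and>
     (\<exists>y L1 Ls L2.
        L = (+) y ` (L1 \<union> Ls \<union> L2) \<and>
        L \<subseteq> (+) y ` periodic_set d P \<and>
        finite Ls \<and> Ls \<noteq> {} \<and> Min Ls = 0 \<and>
        Ls = periodic_set d P \<inter> {0..Max Ls} \<and>
        L1 \<subseteq> {- int M..-1} \<and>
        L2 \<subseteq> (+) (Max Ls) ` {1..int M})"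

definition structure_theorem :: "('a, 'm) monoid_scheme \<Rightarrow> bool" where
  "structure_theorem H \<longleftrightarrow>
     atomic H \<and>
     (\<exists>M \<Delta>. finite \<Delta> \<and> \<Delta> \<noteq> {} \<and> 0 \<notin> \<Delta> \<and>
        (\<forall>L\<in>system_of_lengths H. \<exists>d\<in>\<Delta>. \<exists>P. is_AAMP d P M (int ` L)))"

text \<open>
  The ambient abelian group is a \<^locale>\<open>comm_group\<close>, whose operation is written
  multiplicatively in the library; \<open>list_prod G gs = \<one>\<^bsub>G\<^esub>\<close> therefore says that the terms
  of the sequence sum to zero.
\<close>

definition zero_sum_monoid :: "('g, 'm) monoid_scheme \<Rightarrow> 'g set \<Rightarrow> 'g multiset monoid" where
  "zero_sum_monoid G G0 =
     (free_abelian_monoid G0)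
       \<lparr>carrier := {mset gs | gs. set gs \<subseteq> G0 \<and> list_prod G gs = \<one>\<^bsub>G\<^esub>}\<rparr>"

definition weak_transfer_hom ::
  "('a, 'm) monoid_scheme \<Rightarrow> ('b, 'n) monoid_scheme \<Rightarrow> ('a \<Rightarrow> 'b) \<Rightarrow> bool" where
  "weak_transfer_hom H B \<theta> \<longleftrightarrow>
     \<theta> \<in> hom H B \<and> \<theta> \<one>\<^bsub>H\<^esub> = \<one>\<^bsub>B\<^esub> \<and>
     \<theta> ` carrier H = carrier B \<and>
     {a \<in> carrier H. \<theta> a = \<one>\<^bsub>B\<^esub>} = Units H \<and>
     (\<forall>a\<in>carrier H. \<forall>vs. vs \<noteq> [] \<and> set vs \<subseteq> atoms B \<and> \<theta> a = list_prod B vs \<longrightarrow>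
        (\<exists>us \<tau>. length us = length vs \<and> set us \<subseteq> atoms H \<and> \<tau> permutes {..<length vs} \<and>
           a = list_prod H us \<and> (\<forall>i<length vs. \<theta> (us ! i) = vs ! \<tau> i)))"

text \<open>
  HOL cannot quantify over types inside a formula, so the type of the elements of the abelian
  group is a parameter. A statement that is universal in \<open>'g\<close> and negates this
  predicate excludes every abelian group.
\<close>

definition transfer_krull :: "'g itself \<Rightarrow> ('a, 'm) monoid_scheme \<Rightarrow> bool" where
  "transfer_krull _ H \<longleftrightarrow>
     comm_monoid_cancel H \<and>
     (\<exists>(G :: 'g monoid) G0 \<theta>. comm_group G \<and> G0 \<subseteq> carrier G \<and>
        weak_transfer_hom H (zero_sum_monoid G G0) \<theta>)"

end

theory Submission
  imports Defs
begin

text \<open>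
  Let \<open>c\<close> be an element of a strongly primary monoid with two lengths \<open>p < p + d\<close>. Every element
  with a long factorization is a multiple of \<open>c\<^sup>N\<close>, so its set of lengths contains \<open>N + 1\<close> numbers in
  arithmetic progression. Lengths add up over the coordinates of the product, so the same holds
  there, and large shifts of a fixed finite set do not occur. In a nontrivial \<open>\<B>(G\<^sub>0)\<close>, however, all
  sets \<open>{k}\<close> occur: choose a nonempty zero-sum sequence \<open>v\<close> of minimal support and, for this support,
  of minimal length. All zero-sum sequences over the support of \<open>v\<close> are powers of \<open>v\<close>.

  If the monoid is locally tame, then dividing by a fixed element changes lengths by a bounded amount
  only. Hence the gaps in sets of lengths are bounded, by \<open>g\<close> say. For the least positive difference \<open>d\<close>
  of two lengths of one element \<open>c\<close>, the lengths of \<open>c\<^sup>g\<close> contain a progression with difference \<open>d\<close>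
  that is long enough to fill the gaps of \<open>L(b)\<close> in \<open>L(c\<^sup>g b)\<close>. So sets of lengths are arithmetical
  progressions up to bounded margins, and finite sumsets inherit periodicity inside bounded margins.
\<close>

section \<open>Factorization lengths\<close>

inductive has_length :: "('a, 'm) monoid_scheme \<Rightarrow> 'a \<Rightarrow> nat \<Rightarrow> bool" for H where
  unit: "a \<in> Units H \<Longrightarrow> has_length H a 0"
| atom: "u \<in> atoms H \<Longrightarrow> has_length H a k \<Longrightarrow> has_length H (u \<otimes>\<^bsub>H\<^esub> a) (Suc k)"

lemma list_prod_Nil [simp]: "list_prod H [] = \<one>\<^bsub>H\<^esub>"
  by (simp add: list_prod_def)

lemma list_prod_Cons [simp]: "list_prod H (x # xs) = x \<otimes>\<^bsub>H\<^esub> list_prod H xs"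
  by (simp add: list_prod_def)

lemma (in monoid) list_prod_closed [simp]:
  "set xs \<subseteq> carrier G \<Longrightarrow> list_prod G xs \<in> carrier G"
  by (induction xs) auto

lemma (in monoid) list_prod_append:
  "\<lbrakk>set xs \<subseteq> carrier G; set ys \<subseteq> carrier G\<rbrakk>
    \<Longrightarrow> list_prod G (xs @ ys) = list_prod G xs \<otimes> list_prod G ys"
  by (induction xs) (auto simp: m_assoc)

lemma (in comm_monoid) list_prod_mset_cong:
  "\<lbrakk>mset xs = mset ys; set xs \<subseteq> carrier G\<rbrakk> \<Longrightarrow> list_prod G xs = list_prod G ys"
proof (induction xs arbitrary: ys)
  case (Cons x xs)
  then have "x \<in> set ys"
    by (metis list.set_intros(1) mset_eq_setD)
  then obtain as bs where ys: "ys = as @ x # bs"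
    by (meson split_list)
  have "set ys \<subseteq> carrier G"
    using Cons.prems by (metis mset_eq_setD)
  then have c: "set as \<subseteq> carrier G" "set bs \<subseteq> carrier G" "x \<in> carrier G"
    by (auto simp: ys)
  have "list_prod G xs = list_prod G (as @ bs)"
    using Cons ys by simp
  then show ?case
    using c by (simp add: ys list_prod_append m_lcomm)
qed simp

lemma atoms_subset_nonunits: "atoms H \<subseteq> nonunits H"
  by (auto simp: atoms_def nonunits_def irreducible_def)

lemma atoms_closed: "u \<in> atoms H \<Longrightarrow> u \<in> carrier H"
  by (simp add: atoms_def)

lemma atoms_nonunit: "u \<in> atoms H \<Longrightarrow> u \<notin> Units H"
  by (simp add: atoms_def irreducible_def)

context comm_monoid_cancel
begin

lemma has_length_closed: "has_length G a k \<Longrightarrow> a \<in> carrier G"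
  by (induction rule: has_length.induct) (auto simp: atoms_closed)

lemma Units_mult_iff:
  "\<lbrakk>a \<in> carrier G; b \<in> carrier G\<rbrakk> \<Longrightarrow> a \<otimes> b \<in> Units G \<longleftrightarrow> a \<in> Units G \<and> b \<in> Units G"
  using prod_unit_l prod_unit_r by (metis Units_m_closed unit_factor)

lemma has_length_0_iff: "has_length G a 0 \<longleftrightarrow> a \<in> Units G"
  by (auto elim: has_length.cases intro: has_length.unit)

lemma has_length_Units: "\<lbrakk>has_length G a k; a \<in> Units G\<rbrakk> \<Longrightarrow> k = 0"
  by (erule has_length.cases) (auto simp: Units_mult_iff atoms_closed atoms_nonunit has_length_closed)

lemma atom_mult_unit:
  assumes "u \<in> atoms G" "e \<in> Units G"
  shows "u \<otimes> e \<in> atoms G"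
  using assms irreducible_prod_rI[of u e] by (auto simp: atoms_def)

lemma has_length_mult:
  assumes "has_length G a k" "has_length G b l"
  shows "has_length G (a \<otimes> b) (k + l)"
  using assms(1)
proof (induction rule: has_length.induct)
  case (unit a)
  show ?case
    using assms(2) unit
  proof (induction arbitrary: rule: has_length.induct)
    case (unit b)
    then show ?case by (simp add: has_length.unit)
  next
    case (atom u b l)
    then have "has_length G (u \<otimes> (a \<otimes> b)) (Suc l)"
      by (metis add_0 has_length.atom)
    then show ?case
      using atom m_lcomm[of u a b] by (simp add: atoms_closed has_length_closed Units_closed)
  qed
next
  case (atom u a k)
  then have "has_length G (u \<otimes> (a \<otimes> b)) (Suc (k + l))"
    by (intro has_length.atom)
  then show ?case
    using atom assms(2) by (simp add: m_assoc atoms_closed has_length_closed)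
qed

lemma has_length_atom: "u \<in> atoms G \<Longrightarrow> has_length G u 1"
  using has_length.atom[of u G \<one> 0] by (simp add: has_length.unit atoms_closed)

lemma has_length_list_prod: "set us \<subseteq> atoms G \<Longrightarrow> has_length G (list_prod G us) (length us)"
  by (induction us) (auto intro: has_length.intros)

lemma has_length_imp_list:
  assumes "has_length G a k"
  shows "\<exists>us e. e \<in> Units G \<and> length us = k \<and> set us \<subseteq> atoms G \<and> a = list_prod G us \<otimes> e"
  using assms
proof (induction rule: has_length.induct)
  case (unit a)
  then show ?case
    by (intro exI[of _ "[]"] exI[of _ a]) auto
next
  case (atom u a k)
  then obtain us e where us: "e \<in> Units G" "length us = k" "set us \<subseteq> atoms G"
    "a = list_prod G us \<otimes> e" by blast
  then have "u \<otimes> a = list_prod G (u # us) \<otimes> e"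
    using atom us by (auto simp: m_assoc atoms_closed subset_iff)
  then show ?case
    using us atom by (intro exI[of _ "u # us"] exI[of _ e]) auto
qed

lemma set_of_lengths_eq:
  assumes "a \<in> carrier G"
  shows "set_of_lengths G a = {k. has_length G a k}"
proof (cases "a \<in> Units G")
  case True
  then show ?thesis
    by (auto simp: set_of_lengths_def has_length_0_iff dest: has_length_Units)
next
  case False
  have "\<exists>us. length us = k \<and> set us \<subseteq> atoms G \<and> list_prod G us = a" if k: "has_length G a k" for k
  proof -
    obtain us e where us: "e \<in> Units G" "length us = k" "set us \<subseteq> atoms G"
      "a = list_prod G us \<otimes> e" using has_length_imp_list[OF k] by blast
    have "k \<noteq> 0" using False k by (metis has_length_0_iff)
    then obtain u vs where uv: "us = u # vs" using us by (cases us) auto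
    have "list_prod G (u \<otimes> e # vs) = a"
      using us uv by (auto simp: m_assoc m_comm m_lcomm atoms_closed subset_iff)
    moreover have "set (u \<otimes> e # vs) \<subseteq> atoms G"
      using us uv by (auto intro: atom_mult_unit)
    ultimately show ?thesis
      using us uv by (intro exI[of _ "u \<otimes> e # vs"]) auto
  qed
  moreover have "0 < k" if "has_length G a k" for k
    using that False by (metis has_length_0_iff gr0I)
  ultimately have "{k. 0 < k \<and> (\<exists>us. length us = k \<and> set us \<subseteq> atoms G \<and> list_prod G us = a)}
      = {k. has_length G a k}"
    using has_length_list_prod by blast
  with False show ?thesis by (simp add: set_of_lengths_def)
qed

lemma system_of_lengths_eq:
  "system_of_lengths G = (\<lambda>a. {k. has_length G a k}) ` carrier G"
  by (auto simp: system_of_lengths_def set_of_lengths_eq)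

lemma atomic_iff: "atomic G \<longleftrightarrow> (\<forall>a\<in>carrier G. \<exists>k. has_length G a k)"
proof
  assume "atomic G"
  then show "\<forall>a\<in>carrier G. \<exists>k. has_length G a k"
    unfolding atomic_def nonunits_def
    by (metis Diff_iff has_length.unit has_length_list_prod)
next
  assume r: "\<forall>a\<in>carrier G. \<exists>k. has_length G a k"
  show "atomic G"
    unfolding atomic_def nonunits_def
  proof
    fix a assume a: "a \<in> carrier G - Units G"
    then obtain k where "k \<in> set_of_lengths G a"
      using r by (auto simp: set_of_lengths_eq)
    then show "\<exists>us. set us \<subseteq> atoms G \<and> list_prod G us = a"
      using a by (auto simp: set_of_lengths_def)
  qed
qed

lemma has_length_pow:
  "has_length G a k \<Longrightarrow> has_length G (a [^] (n::nat)) (n * k)"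
proof (induction n)
  case 0
  then show ?case by (simp add: has_length.unit)
next
  case (Suc n)
  then show ?case using has_length_mult[of "a [^] n" "n * k" a k] by (simp add: add.commute)
qed

lemma has_length_pow_progression:
  assumes p: "has_length G c p" and q: "has_length G c (p + d)" and j: "j \<le> n"
  shows "has_length G (c [^] (n::nat)) (n * p + j * d)"
proof -
  have "has_length G (c [^] j \<otimes> c [^] (n - j)) (j * (p + d) + (n - j) * p)"
    using p q by (intro has_length_mult has_length_pow)
  moreover have "c [^] j \<otimes> c [^] (n - j) = c [^] n"
    using j p by (simp add: nat_pow_mult has_length_closed)
  moreover have "j * (p + d) + (n - j) * p = n * p + j * d"
  proof -
    obtain i where "n = j + i" using j le_iff_add by blast
    then show ?thesis by (simp add: algebra_simps)
  qed
  ultimately show ?thesis by simp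
qed

definition BF_element :: "'a \<Rightarrow> nat \<Rightarrow> bool" where
  "BF_element a N \<longleftrightarrow> (\<forall>xs. set xs \<subseteq> nonunits G \<and> list_prod G xs = a \<longrightarrow> length xs \<le> N)"

lemma BF_element_has_length:
  assumes "a \<in> carrier G" "BF_element a N"
  shows "\<exists>k. has_length G a k"
  using assms
proof (induction N arbitrary: a)
  case 0
  have "a \<in> Units G"
  proof (rule ccontr)
    assume "a \<notin> Units G"
    then have "set [a] \<subseteq> nonunits G \<and> list_prod G [a] = a"
      using 0 by (simp add: nonunits_def)
    then have "length [a] \<le> 0" using 0 unfolding BF_element_def by blast
    then show False by simp
  qed
  then show ?case by (auto intro: has_length.unit)
next
  case (Suc N)
  consider "a \<in> Units G" | "a \<in> atoms G" |
    b c where "b \<in> nonunits G" "c \<in> nonunits G" "a = b \<otimes> c"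
    using Suc.prems(1) atoms_iff[of a] by (auto simp: nonunits_def)
  then show ?case
  proof cases
    case 3
    have BF: "BF_element x N" if "x \<in> nonunits G" "y \<in> nonunits G" "a = y \<otimes> x" for x y
      unfolding BF_element_def
    proof (intro allI impI, elim conjE)
      fix xs assume xs: "set xs \<subseteq> nonunits G" "list_prod G xs = x"
      have "list_prod G (y # xs) = a"
        using xs that by simp
      moreover have "set (y # xs) \<subseteq> nonunits G"
        using xs that by simp
      ultimately have "length (y # xs) \<le> Suc N"
        using Suc.prems(2) unfolding BF_element_def by blast
      then show "length xs \<le> N" by simp
    qed
    have c: "b \<in> carrier G" "c \<in> carrier G"
      using 3 by (auto simp: nonunits_def)
    obtain k l where "has_length G b k" "has_length G c l"
      using Suc.IH[OF c(1)] Suc.IH[OF c(2)] BF 3 m_comm[OF c] by metis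
    then show ?thesis
      using 3 has_length_mult by blast
  qed (auto intro: has_length.unit has_length_atom)
qed

lemma BF_element_bound:
  assumes "a \<in> carrier G" "BF_element a N" "has_length G a k"
  shows "k \<le> N"
proof (cases "a \<in> Units G")
  case False
  have "k \<in> set_of_lengths G a" using assms set_of_lengths_eq by blast
  then show ?thesis
    using assms False atoms_subset_nonunits
    by (fastforce simp: set_of_lengths_def BF_element_def)
qed (use assms has_length_Units in auto)

end

section \<open>Strongly primary monoids\<close>

lemma strongly_primary_dvd_long:
  assumes "strongly_primary H" "c \<in> carrier H"
  shows "\<exists>K. \<forall>a k. has_length H a k \<and> K \<le> k \<longrightarrow> (\<exists>b\<in>carrier H. a = c \<otimes>\<^bsub>H\<^esub> b)"
proof -
  interpret comm_monoid_cancel H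
    using assms(1) by (simp add: strongly_primary_def)
  show ?thesis
  proof (cases "c \<in> Units H")
    case True
    then show ?thesis
      by (metis Units_closed Units_inv_closed Units_r_inv has_length_closed l_one m_assoc m_closed)
  next
    case False
    then obtain K where K: "set_power H (nonunits H) K \<subseteq> c <#\<^bsub>H\<^esub> carrier H"
      using assms unfolding strongly_primary_def nonunits_def by (metis DiffI)
    have "\<exists>b\<in>carrier H. a = c \<otimes>\<^bsub>H\<^esub> b" if a: "has_length H a k" "K \<le> k" for a k
    proof -
      obtain us e where us: "e \<in> Units H" "length us = k" "set us \<subseteq> atoms H"
        "a = list_prod H us \<otimes>\<^bsub>H\<^esub> e" using has_length_imp_list[OF a(1)] by blast
      define xs ys where "xs = take K us" and "ys = drop K us"
      have xy: "us = xs @ ys" "length xs = K" using a us by (auto simp: xs_def ys_def)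
      have sub: "set xs \<subseteq> nonunits H" "set xs \<subseteq> carrier H" "set ys \<subseteq> carrier H"
        using us xy atoms_subset_nonunits[of H] by (auto simp: nonunits_def)
      then have "list_prod H xs \<in> set_power H (nonunits H) K"
        using xy by (auto simp: set_power_def)
      then obtain b where b: "b \<in> carrier H" "list_prod H xs = c \<otimes>\<^bsub>H\<^esub> b"
        using K by (auto simp: l_coset_def)
      have "a = c \<otimes>\<^bsub>H\<^esub> (b \<otimes>\<^bsub>H\<^esub> (list_prod H ys \<otimes>\<^bsub>H\<^esub> e))"
        using us xy sub b assms(2) by (simp add: list_prod_append m_assoc Units_closed)
      then show ?thesis using b sub us by (blast intro: m_closed list_prod_closed Units_closed)
    qed
    then show ?thesis by blast
  qed
qed

lemma strongly_primary_BF: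
  assumes "strongly_primary H" "a \<in> carrier H"
  shows "\<exists>N. comm_monoid_cancel.BF_element H a N"
proof -
  interpret comm_monoid_cancel H
    using assms(1) by (simp add: strongly_primary_def)
  have "\<exists>K. set_power H (nonunits H) K \<subseteq> a <#\<^bsub>H\<^esub> carrier H"
  proof (cases "a \<in> Units H")
    case True
    have "x \<in> a <#\<^bsub>H\<^esub> carrier H" if "x \<in> carrier H" for x
    proof -
      have "x = a \<otimes>\<^bsub>H\<^esub> (inv\<^bsub>H\<^esub> a \<otimes>\<^bsub>H\<^esub> x)"
        using that True m_assoc[of a "inv\<^bsub>H\<^esub> a" x] by (simp add: Units_closed)
      then show ?thesis
        using that True by (auto simp: l_coset_def)
    qed
    then have "set_power H (nonunits H) 0 \<subseteq> a <#\<^bsub>H\<^esub> carrier H"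
      by (auto simp: set_power_def)
    then show ?thesis by blast
  qed (use assms in \<open>auto simp: strongly_primary_def nonunits_def\<close>)
  then obtain K where K: "set_power H (nonunits H) K \<subseteq> a <#\<^bsub>H\<^esub> carrier H"
    by blast
  have "length us \<le> K" if us: "set us \<subseteq> nonunits H" "list_prod H us = a" for us
  proof (rule ccontr)
    assume "\<not> length us \<le> K"
    then obtain xs y ys where xy: "us = xs @ y # ys" "length xs = K"
      by (metis not_le id_take_nth_drop length_take min.absorb4)
    have sub: "set xs \<subseteq> nonunits H" "set xs \<subseteq> carrier H" "set ys \<subseteq> carrier H"
      "y \<in> carrier H" "y \<notin> Units H"
      using us xy by (auto simp: nonunits_def)
    then have "list_prod H xs \<in> set_power H (nonunits H) K"
      using xy by (auto simp: set_power_def)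
    then obtain b where b: "b \<in> carrier H" "list_prod H xs = a \<otimes>\<^bsub>H\<^esub> b"
      using K by (auto simp: l_coset_def)
    have "a \<otimes>\<^bsub>H\<^esub> \<one>\<^bsub>H\<^esub> = a \<otimes>\<^bsub>H\<^esub> (b \<otimes>\<^bsub>H\<^esub> (list_prod H ys) \<otimes>\<^bsub>H\<^esub> y)"
      using us xy sub b assms(2) by (simp add: list_prod_append m_assoc m_comm[of y])
    then have "\<one>\<^bsub>H\<^esub> = b \<otimes>\<^bsub>H\<^esub> (list_prod H ys) \<otimes>\<^bsub>H\<^esub> y"
      using sub b assms(2) by (metis l_cancel list_prod_closed m_closed one_closed)
    then have "y \<in> Units H"
      using sub b Units_mult_iff[of "b \<otimes>\<^bsub>H\<^esub> (list_prod H ys)" y] Units_one_closed by simp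
    then show False using sub by blast
  qed
  then show ?thesis by (auto simp: BF_element_def)
qed

lemma strongly_primary_has_length:
  assumes "strongly_primary H" "a \<in> carrier H"
  shows "\<exists>k. has_length H a k"
  using strongly_primary_BF[OF assms] comm_monoid_cancel.BF_element_has_length assms
  by (metis strongly_primary_def)

lemma strongly_primary_finite_lengths:
  assumes "strongly_primary H" "a \<in> carrier H"
  shows "finite {k. has_length H a k}"
proof -
  obtain N where "comm_monoid_cancel.BF_element H a N" using strongly_primary_BF[OF assms] by blast
  then have "{k. has_length H a k} \<subseteq> {..N}"
    using assms comm_monoid_cancel.BF_element_bound by (fastforce simp: strongly_primary_def)
  then show ?thesis by (rule finite_subset) simp
qed

lemma not_half_factorial_witness:
  assumes "strongly_primary H" "\<not> half_factorial H"
  shows "\<exists>c p d. c \<in> carrier H \<and> 0 < d \<and> has_length H c p \<and> has_length H c (p + d)"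
proof -
  interpret comm_monoid_cancel H
    using assms(1) by (simp add: strongly_primary_def)
  obtain c where c: "c \<in> carrier H" "card {k. has_length H c k} \<noteq> 1"
    using assms(2) unfolding half_factorial_def system_of_lengths_eq by blast
  obtain p where p: "has_length H c p"
    using strongly_primary_has_length[OF assms(1) c(1)] by blast
  obtain q where q: "has_length H c q" "q \<noteq> p"
  proof -
    have "{k. has_length H c k} \<noteq> {p}" using c by auto
    then show ?thesis using p that by blast
  qed
  show ?thesis
  proof (cases "p < q")
    case True
    then show ?thesis using p q c by (metis zero_less_diff add_diff_inverse_nat less_not_sym)
  next
    case False
    then have "q < p" using q by simp
    then show ?thesis using p q c by (metis zero_less_diff add_diff_inverse_nat less_not_sym)
  qed
qed

definition long_progressions :: "('a, 'm) monoid_scheme \<Rightarrow> bool" where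
  "long_progressions H \<longleftrightarrow> (\<forall>N. \<exists>K. \<forall>a k. has_length H a k \<and> K \<le> k \<longrightarrow>
     (\<exists>y d. 0 < d \<and> (\<forall>j\<le>N. has_length H a (y + j * d))))"

lemma strongly_primary_long_progressions:
  assumes "strongly_primary H" "\<not> half_factorial H"
  shows "long_progressions H"
  unfolding long_progressions_def
proof
  interpret comm_monoid_cancel H
    using assms(1) by (simp add: strongly_primary_def)
  fix N :: nat
  obtain c p d where c: "c \<in> carrier H" "0 < d" "has_length H c p" "has_length H c (p + d)"
    using not_half_factorial_witness[OF assms] by blast
  obtain K where K: "\<And>a k. has_length H a k \<Longrightarrow> K \<le> k \<Longrightarrow> \<exists>b\<in>carrier H. a = (c [^]\<^bsub>H\<^esub> N) \<otimes>\<^bsub>H\<^esub> b"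
    using strongly_primary_dvd_long[OF assms(1), of "c [^]\<^bsub>H\<^esub> N"] c by auto
  have "\<exists>y d. 0 < d \<and> (\<forall>j\<le>N. has_length H a (y + j * d))" if a: "has_length H a k" "K \<le> k" for a k
  proof -
    obtain b where b: "b \<in> carrier H" "a = (c [^]\<^bsub>H\<^esub> N) \<otimes>\<^bsub>H\<^esub> b" using K a by blast
    obtain r where r: "has_length H b r"
      using strongly_primary_has_length[OF assms(1) b(1)] by blast
    have "has_length H a ((r + N * p) + j * d)" if "j \<le> N" for j
      using has_length_mult[OF has_length_pow_progression[OF c(3,4) that] r] b(2)
      by (simp add: algebra_simps)
    then show ?thesis using c(2) by blast
  qed
  then show "\<exists>K. \<forall>a k. has_length H a k \<and> K \<le> k \<longrightarrow>
     (\<exists>y d. 0 < d \<and> (\<forall>j\<le>N. has_length H a (y + j * d)))" by blast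
qed

text \<open>A set of lengths that contains a large number has more than \<open>card L\<close> elements.\<close>

lemma long_progressions_shift:
  assumes "long_progressions H" "comm_monoid_cancel H" "finite L" "L \<noteq> {}"
  shows "\<exists>y0. \<forall>y\<ge>y0. (+) y ` L \<notin> system_of_lengths H"
proof -
  interpret comm_monoid_cancel H by fact
  obtain K where K: "\<And>a k. has_length H a k \<Longrightarrow> K \<le> k \<Longrightarrow>
     \<exists>y d. 0 < d \<and> (\<forall>j\<le>card L. has_length H a (y + j * d))"
    using assms(1) unfolding long_progressions_def by meson
  obtain l where l: "l \<in> L" using assms(4) by blast
  have "(+) y ` L \<notin> system_of_lengths H" if y: "K \<le> y" for y
  proof
    assume "(+) y ` L \<in> system_of_lengths H"
    then obtain a where a: "(+) y ` L = {k. has_length H a k}"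
      by (auto simp: system_of_lengths_eq)
    then have "has_length H a (y + l)" using l by auto
    then obtain z d where d: "0 < d" "\<forall>j\<le>card L. has_length H a (z + j * d)"
      using K[of a "y + l"] y by (meson trans_le_add1)
    have "(\<lambda>j. z + j * d) ` {..card L} \<subseteq> (+) y ` L" using a d by auto
    then have "card ((\<lambda>j. z + j * d) ` {..card L}) \<le> card ((+) y ` L)"
      by (intro card_mono) (use assms in auto)
    moreover have "card ((\<lambda>j. z + j * d) ` {..card L}) = Suc (card L)"
      using d(1) by (subst card_image) (auto simp: inj_on_def)
    moreover have "card ((+) y ` L) \<le> card L" using assms card_image_le by blast
    ultimately show False by simp
  qed
  then show ?thesis by blast
qed

section \<open>Almost arithmetical multiprogressions\<close>

text \<open>
  In terms of its minimum and maximum: membership in \<open>S\<close> is periodic modulo \<open>d\<close>, and decided by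
  the residue classes that \<open>S\<close> meets, outside margins of length \<open>M\<close> at both ends.
\<close>

definition central_periodic :: "nat \<Rightarrow> nat \<Rightarrow> int set \<Rightarrow> bool" where
  "central_periodic d M S \<longleftrightarrow>
     (\<forall>x\<in>S. \<forall>a\<in>S. \<forall>b\<in>S. \<forall>y. int d dvd y - x \<and> a + int M \<le> y \<and> y + int M \<le> b \<longrightarrow> y \<in> S)"

lemma central_periodicD:
  "\<lbrakk>central_periodic d M S; x \<in> S; a \<in> S; b \<in> S; int d dvd y - x; a + int M \<le> y; y + int M \<le> b\<rbrakk>
    \<Longrightarrow> y \<in> S"
  unfolding central_periodic_def by blast

lemma central_periodic_mono:
  assumes "central_periodic d M S" "d dvd e" "M \<le> N"
  shows "central_periodic e N S"
  unfolding central_periodic_def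
proof (intro ballI allI impI, elim conjE)
  fix x a b y
  assume *: "x \<in> S" "a \<in> S" "b \<in> S" "int e dvd y - x" "a + int N \<le> y" "y + int N \<le> b"
  have "int d dvd int e" using assms(2) by simp
  then have "int d dvd y - x" using *(4) dvd_trans by blast
  moreover have "a + int M \<le> y" "y + int M \<le> b" using *(5,6) assms(3) by linarith+
  ultimately show "y \<in> S"
    using central_periodicD[OF assms(1) *(1,2,3)] by blast
qed

lemma ex_congruent_in_interval:
  fixes l h x :: int
  assumes "0 < d" "l + int d \<le> h + 1"
  shows "\<exists>y. l \<le> y \<and> y \<le> h \<and> int d dvd y - x"
proof (intro exI conjI)
  let ?y = "l + (x - l) mod int d"
  show "l \<le> ?y" using assms by simp
  have "(x - l) mod int d < int d" using assms by simp
  then show "?y \<le> h" using assms by linarith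
  have "?y - x = int d * (- ((x - l) div int d))"
    using minus_mod_eq_mult_div[of "x - l" "int d"] by simp
  then show "int d dvd ?y - x" by simp
qed

definition sumset :: "int set \<Rightarrow> int set \<Rightarrow> int set" where
  "sumset A B = {x + y | x y. x \<in> A \<and> y \<in> B}"

lemma central_periodic_add_short:
  assumes "central_periodic d M A"
    and A: "a1 \<in> A" "b1 \<in> A" and B: "x2 \<in> B" "a2 \<le> x2" "x2 \<le> b2"
    and short: "b2 - a2 < 2 * int M + int d"
    and x: "x1 \<in> A" "int d dvd y - (x1 + x2)"
    and y: "a1 + a2 + (3 * int M + int d) \<le> y" "y + (3 * int M + int d) \<le> b1 + b2"
  shows "y \<in> sumset A B"
proof -
  have "int d dvd (y - x2) - x1" using x by (simp add: algebra_simps)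
  moreover have "a1 + int M \<le> y - x2" "y - x2 + int M \<le> b1"
    using B short y by linarith+
  ultimately have "y - x2 \<in> A"
    using central_periodicD[OF assms(1) x(1) A] by blast
  then show ?thesis using B(1) unfolding sumset_def by force
qed

lemma central_periodic_sumset:
  assumes d: "0 < d"
    and A: "finite A" "A \<noteq> {}" "central_periodic d M A"
    and B: "finite B" "B \<noteq> {}" "central_periodic d M B"
  shows "central_periodic d (3 * M + d) (sumset A B)"
  unfolding central_periodic_def
proof (intro ballI allI impI, elim conjE)
  fix x a b y
  assume *: "x \<in> sumset A B" "a \<in> sumset A B" "b \<in> sumset A B" "int d dvd y - x"
    "a + int (3 * M + d) \<le> y" "y + int (3 * M + d) \<le> b"
  obtain x1 x2 where x: "x1 \<in> A" "x2 \<in> B" "x = x1 + x2"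
    using * by (auto simp: sumset_def)
  define a1 a2 b1 b2 where "a1 = Min A" and "a2 = Min B" and "b1 = Max A" and "b2 = Max B"
  have in1: "a1 \<in> A" "b1 \<in> A" and in2: "a2 \<in> B" "b2 \<in> B"
    using A B by (auto simp: a1_def a2_def b1_def b2_def)
  have bnd1: "a1 \<le> z" "z \<le> b1" if "z \<in> A" for z using that A by (auto simp: a1_def b1_def)
  have bnd2: "a2 \<le> z" "z \<le> b2" if "z \<in> B" for z using that B by (auto simp: a2_def b2_def)
  have "a1 + a2 \<le> a" "b \<le> b1 + b2"
    using *(2,3) bnd1 bnd2 by (auto simp: sumset_def intro: add_mono)
  then have y: "a1 + a2 + (3 * int M + int d) \<le> y" "y + (3 * int M + int d) \<le> b1 + b2"
    using *(5,6) by auto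
  consider "b2 - a2 < 2 * int M + int d" | "b1 - a1 < 2 * int M + int d" |
    "b1 - a1 \<ge> 2 * int M + int d" "b2 - a2 \<ge> 2 * int M + int d" by linarith
  then show "y \<in> sumset A B"
  proof cases
    case 1
    then show ?thesis
      using central_periodic_add_short[OF A(3) in1 x(2) bnd2[OF x(2)] _ x(1)] *(4) x(3) y by blast
  next
    case 2
    have "y \<in> sumset B A"
      using central_periodic_add_short[OF B(3) in2 x(1) bnd1[OF x(1)] 2 x(2)] *(4) x(3) y
      by (simp add: add.commute)
    then show ?thesis unfolding sumset_def by (blast intro: add.commute)
  next
    case 3
    have "max (a1 + int M) (y - b2 + int M) + int d \<le> min (b1 - int M) (y - a2 - int M) + 1"
      using 3 y by linarith
    from ex_congruent_in_interval[OF d this]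
    obtain z where z: "max (a1 + int M) (y - b2 + int M) \<le> z"
      "z \<le> min (b1 - int M) (y - a2 - int M)" "int d dvd z - x1"
      by blast
    have "z \<in> A"
      using z by (intro central_periodicD[OF A(3) x(1) in1]) auto
    moreover have "y - z \<in> B"
    proof (rule central_periodicD[OF B(3) x(2) in2])
      have "y - z - x2 = (y - x) - (z - x1)" using x by simp
      then show "int d dvd y - z - x2" using *(4) z(3) by (metis dvd_diff)
    qed (use z in auto)
    ultimately show ?thesis unfolding sumset_def by force
  qed
qed

definition sum_family :: "'i set \<Rightarrow> ('i \<Rightarrow> int set) \<Rightarrow> int set" where
  "sum_family J S = {(\<Sum>i\<in>J. f i) | f. \<forall>i\<in>J. f i \<in> S i}"

lemma sum_family_insert:
  assumes "finite J" "j \<notin> J"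
  shows "sum_family (insert j J) S = sumset (S j) (sum_family J S)"
proof (intro equalityI subsetI)
  fix x assume "x \<in> sum_family (insert j J) S"
  then obtain f where f: "\<forall>i\<in>insert j J. f i \<in> S i" "x = sum f (insert j J)"
    unfolding sum_family_def by blast
  then have "x = f j + sum f J" using assms by simp
  then show "x \<in> sumset (S j) (sum_family J S)"
    using f(1) unfolding sum_family_def sumset_def by blast
next
  fix x assume "x \<in> sumset (S j) (sum_family J S)"
  then obtain s f where s: "s \<in> S j" "\<forall>i\<in>J. f i \<in> S i" "x = s + sum f J"
    unfolding sum_family_def sumset_def by blast
  have "sum (f(j := s)) J = sum f J" using assms by (intro sum.cong) auto
  then have "x = sum (f(j := s)) (insert j J)" using assms s by simp
  then show "x \<in> sum_family (insert j J) S"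
    using s unfolding sum_family_def by (intro CollectI exI[of _ "f(j := s)"]) auto
qed

lemma finite_sumset: "\<lbrakk>finite A; finite B\<rbrakk> \<Longrightarrow> finite (sumset A B)"
  unfolding sumset_def by (rule finite_image_set2) auto

lemma central_periodic_sum_family:
  assumes "finite J" "0 < d"
  shows "\<exists>N. \<forall>S. (\<forall>i\<in>J. finite (S i) \<and> S i \<noteq> {} \<and> central_periodic d M (S i)) \<longrightarrow>
    finite (sum_family J S) \<and> sum_family J S \<noteq> {} \<and> central_periodic d N (sum_family J S)"
  using assms(1)
proof induction
  case empty
  have "sum_family {} S = {0}" for S :: "'a \<Rightarrow> int set" by (simp add: sum_family_def)
  then show ?case by (auto simp: central_periodic_def)
next
  case (insert j J)
  then obtain N where N: "\<And>S. (\<forall>i\<in>J. finite (S i) \<and> S i \<noteq> {} \<and> central_periodic d M (S i)) \<Longrightarrow>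
    finite (sum_family J S) \<and> sum_family J S \<noteq> {} \<and> central_periodic d N (sum_family J S)" by blast
  define N' where "N' = max M N"
  show ?case
  proof (intro exI[of _ "3 * N' + d"] allI impI)
    fix S assume S: "\<forall>i\<in>insert j J. finite (S i) \<and> S i \<noteq> {} \<and> central_periodic d M (S i)"
    have 1: "finite (sum_family J S)" "sum_family J S \<noteq> {}" "central_periodic d N' (sum_family J S)"
      using N[of S] S central_periodic_mono[of d N "sum_family J S" d N'] by (simp_all add: N'_def)
    have 2: "finite (S j)" "S j \<noteq> {}" "central_periodic d N' (S j)"
      using S central_periodic_mono[of d M "S j" d N'] by (simp_all add: N'_def)
    have "sumset (S j) (sum_family J S) \<noteq> {}"
      using 1 2 by (auto simp: sumset_def)
    then show "finite (sum_family (insert j J) S) \<and> sum_family (insert j J) S \<noteq> {} \<and>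
        central_periodic d (3 * N' + d) (sum_family (insert j J) S)"
      using 1 2 central_periodic_sumset[OF assms(2) 2 1] insert.hyps
      by (simp add: sum_family_insert finite_sumset)
  qed
qed

lemma mem_periodic_set_iff:
  assumes "0 < d" "{0, int d} \<subseteq> P" "P \<subseteq> {0..int d}"
  shows "z \<in> periodic_set d P \<longleftrightarrow> z mod int d \<in> P"
proof
  assume "z \<in> periodic_set d P"
  then obtain p k where p: "p \<in> P" "z = p + int d * k" by (auto simp: periodic_set_def)
  then have "z mod int d = p mod int d" by simp
  then show "z mod int d \<in> P"
    using assms p by (cases "p = int d") (auto simp: subset_iff)
next
  assume "z mod int d \<in> P"
  then show "z \<in> periodic_set d P"
    unfolding periodic_set_def
    by (intro CollectI exI[of _ "z mod int d"] exI[of _ "z div int d"]) auto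
qed

lemma is_AAMPI:
  assumes "0 < d" "{0, int d} \<subseteq> P" "P \<subseteq> {0..int d}"
    and "L = (+) y ` (L1 \<union> Ls \<union> L2)" "L \<subseteq> (+) y ` periodic_set d P"
    and "finite Ls" "Ls \<noteq> {}" "Min Ls = 0" "Ls = periodic_set d P \<inter> {0..Max Ls}"
    and "L1 \<subseteq> {- int M..-1}" "L2 \<subseteq> (+) (Max Ls) ` {1..int M}"
  shows "is_AAMP d P M L"
  unfolding is_AAMP_def using assms by blast

lemma is_AAMP_of_central_periodic:
  assumes d: "0 < d" and S: "finite S" "S \<noteq> {}" and per: "central_periodic d M S"
  shows "\<exists>P. is_AAMP d P (2 * M + 2 * d) S"
proof -
  define a b where "a = Min S" and "b = Max S"
  have ab: "a \<in> S" "b \<in> S" using S by (auto simp: a_def b_def)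
  have bnd: "a \<le> z" "z \<le> b" if "z \<in> S" for z using S that by (auto simp: a_def b_def)
  show ?thesis
  proof (cases "b - a \<le> 2 * int M + 2 * int d")
    case True
    let ?P = "{0..int d}"
    have all: "periodic_set d ?P = UNIV"
      using d mem_periodic_set_iff[OF d, of ?P] pos_mod_bound[of "int d"] by (auto simp: less_imp_le)
    have "is_AAMP d ?P (2 * M + 2 * d) S"
    proof (rule is_AAMPI[where y = a and ?L1.0 = "{}" and Ls = "{0}" and ?L2.0 = "(\<lambda>z. z - a) ` (S - {a})"])
      show "S = (+) a ` ({} \<union> {0} \<union> (\<lambda>z. z - a) ` (S - {a}))"
        using ab by (auto simp: image_iff)
      show "(\<lambda>z. z - a) ` (S - {a}) \<subseteq> (+) (Max {0}) ` {1..int (2 * M + 2 * d)}"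
      proof
        fix w assume "w \<in> (\<lambda>z. z - a) ` (S - {a})"
        then obtain z where "z \<in> S" "z \<noteq> a" "w = z - a" by blast
        then show "w \<in> (+) (Max {0}) ` {1..int (2 * M + 2 * d)}"
          using bnd[of z] True by auto
      qed
      show "S \<subseteq> (+) a ` periodic_set d ?P"
        unfolding all by (simp add: surj_plus)
    qed (use d all in auto)
    then show ?thesis by blast
  next
    case False
    obtain w where w: "a + int M \<le> w" "w \<le> a + int M + int d" "int d dvd w - a"
      using ex_congruent_in_interval[OF d, of "a + int M" "a + int M + int d" a] by auto
    have wS: "w \<in> S"
      using w False by (intro central_periodicD[OF per ab(1) ab]) (blast | linarith)+
    obtain v where v: "b - int M - int d \<le> v" "v \<le> b - int M" "int d dvd v - w"
      using ex_congruent_in_interval[OF d, of "b - int M - int d" "b - int M" w] by auto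
    have vS: "v \<in> S"
      using v False w by (intro central_periodicD[OF per wS ab]) (blast | linarith)+
    define P where "P = insert (int d) ((\<lambda>z. (z - w) mod int d) ` S)"
    have P: "{0, int d} \<subseteq> P" "P \<subseteq> {0..int d}"
      using d wS pos_mod_bound[of "int d"] by (auto simp: P_def less_imp_le image_iff intro!: bexI[of _ w])
    note mem = mem_periodic_set_iff[OF d P]
    define Ls where "Ls = (\<lambda>z. z - w) ` (S \<inter> {w..b - int M})"
    have fin: "finite Ls" using S by (simp add: Ls_def)
    have "w \<le> b - int M" using w False by linarith
    then have 0: "0 \<in> Ls" using wS by (auto simp: Ls_def image_iff intro!: bexI[of _ w])
    have Min: "Min Ls = 0"
      using fin 0 by (intro Min_eqI) (auto simp: Ls_def)
    have vw: "w \<le> v" using v w False by linarith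
    then have "v - w \<in> Ls" using vS v by (auto simp: Ls_def)
    then have Maxge: "v - w \<le> Max Ls" using fin by simp
    have MaxLs: "Max Ls \<in> Ls" using fin 0 Max_in by blast
    then have Maxle: "w + Max Ls \<le> b - int M" by (auto simp: Ls_def)
    have sub: "S \<subseteq> (+) w ` periodic_set d P"
    proof
      fix z assume "z \<in> S"
      then have "z - w \<in> periodic_set d P" by (subst mem) (simp add: P_def)
      then show "z \<in> (+) w ` periodic_set d P" by (auto simp: image_iff intro!: bexI[of _ "z - w"])
    qed
    have Ls: "Ls = periodic_set d P \<inter> {0..Max Ls}"
    proof (intro equalityI subsetI)
      fix z assume z: "z \<in> Ls"
      then have "z + w \<in> S" "0 \<le> z" by (auto simp: Ls_def)
      moreover have "z \<le> Max Ls" using z fin by simp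
      ultimately show "z \<in> periodic_set d P \<inter> {0..Max Ls}" using sub by force
    next
      fix z assume z: "z \<in> periodic_set d P \<inter> {0..Max Ls}"
      then have "z mod int d \<in> P" by (simp add: mem)
      moreover have "z mod int d \<noteq> int d" using d pos_mod_bound[of "int d" z] by linarith
      ultimately obtain x where x: "x \<in> S" "z mod int d = (x - w) mod int d" by (auto simp: P_def)
      then have "int d dvd z + w - x"
        by (simp add: mod_eq_dvd_iff algebra_simps)
      then have "z + w \<in> S"
        by (rule central_periodicD[OF per x(1) ab]) (use z Maxle w in auto)
      then show "z \<in> Ls" using z Maxle by (auto simp: Ls_def image_iff intro!: bexI[of _ "z + w"])
    qed
    have "is_AAMP d P (2 * M + 2 * d) S"
    proof (rule is_AAMPI[where y = w and ?L1.0 = "(\<lambda>z. z - w) ` (S \<inter> {..<w})" and Ls = Ls and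
        ?L2.0 = "(\<lambda>z. z - w) ` (S \<inter> {w + Max Ls<..})"])
      show "S = (+) w ` ((\<lambda>z. z - w) ` (S \<inter> {..<w}) \<union> Ls \<union> (\<lambda>z. z - w) ` (S \<inter> {w + Max Ls<..}))"
      proof (intro equalityI subsetI)
        fix z assume z: "z \<in> S"
        consider "z < w" | "w + Max Ls < z" | "w \<le> z" "z \<le> w + Max Ls" by linarith
        then show "z \<in> (+) w ` ((\<lambda>z. z - w) ` (S \<inter> {..<w}) \<union> Ls \<union> (\<lambda>z. z - w) ` (S \<inter> {w + Max Ls<..}))"
        proof cases
          case 3
          then have "z - w \<in> Ls" using z Maxle by (auto simp: Ls_def)
          then show ?thesis by (auto simp: image_iff intro!: bexI[of _ "z - w"])
        qed (use z in \<open>auto simp: image_iff intro!: bexI[of _ "z - w"]\<close>)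
      qed (auto simp: Ls_def)
      show "(\<lambda>z. z - w) ` (S \<inter> {..<w}) \<subseteq> {- int (2 * M + 2 * d)..- 1}"
        using w bnd by force
      show "(\<lambda>z. z - w) ` (S \<inter> {w + Max Ls<..}) \<subseteq> (+) (Max Ls) ` {1..int (2 * M + 2 * d)}"
      proof
        fix u assume "u \<in> (\<lambda>z. z - w) ` (S \<inter> {w + Max Ls<..})"
        then obtain z where z: "z \<in> S" "w + Max Ls < z" "u = z - w" by auto
        then have "u - Max Ls \<in> {1..int (2 * M + 2 * d)}"
          using bnd[of z] v Maxge by auto
        then show "u \<in> (+) (Max Ls) ` {1..int (2 * M + 2 * d)}"
          by (auto simp: image_iff intro!: bexI[of _ "u - Max Ls"])
      qed
      show "Ls \<noteq> {}" using 0 by blast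
    qed (fact d P sub fin Min Ls)+
    then show ?thesis by blast
  qed
qed

section \<open>Products of monoids\<close>

locale comm_monoid_cancel_family =
  fixes I :: "'i set" and D :: "'i \<Rightarrow> ('a, 'm) monoid_scheme"
  assumes factor: "i \<in> I \<Longrightarrow> comm_monoid_cancel (D i)"
    and finite_index: "finite I"
begin

abbreviation P :: "('i \<Rightarrow> 'a) monoid" where
  "P \<equiv> product_group I D"

lemma factor_monoid: "i \<in> I \<Longrightarrow> monoid (D i)"
  using factor comm_monoid_cancel.axioms(1) monoid_cancel.axioms(1) by blast

lemma factor_closed: "i \<in> I \<Longrightarrow> x \<in> carrier P \<Longrightarrow> x i \<in> carrier (D i)"
  by auto

lemma product_comm_monoid_cancel: "comm_monoid_cancel P"
proof (rule comm_monoid_cancelI)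
  note fm = factor_monoid
  have fc: "comm_monoid (D i)" if "i \<in> I" for i
    using factor[OF that] comm_monoid_cancel.axioms(2) by blast
  show "comm_monoid P"
  proof (rule comm_monoidI)
    show "x \<otimes>\<^bsub>P\<^esub> y \<in> carrier P" if "x \<in> carrier P" "y \<in> carrier P" for x y
      using that fm by (auto intro!: monoid.m_closed)
    show "\<one>\<^bsub>P\<^esub> \<in> carrier P"
      using fm by (auto intro!: monoid.one_closed)
    show "(x \<otimes>\<^bsub>P\<^esub> y) \<otimes>\<^bsub>P\<^esub> z = x \<otimes>\<^bsub>P\<^esub> (y \<otimes>\<^bsub>P\<^esub> z)"
      if "x \<in> carrier P" "y \<in> carrier P" "z \<in> carrier P" for x y z
      using that fm by (auto simp: PiE_iff monoid.m_assoc intro!: restrict_ext)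
    show "\<one>\<^bsub>P\<^esub> \<otimes>\<^bsub>P\<^esub> x = x" if "x \<in> carrier P" for x
      using that fm by (auto simp: PiE_iff monoid.l_one extensional_def intro!: ext)
    show "x \<otimes>\<^bsub>P\<^esub> y = y \<otimes>\<^bsub>P\<^esub> x" if "x \<in> carrier P" "y \<in> carrier P" for x y
      using that fc by (auto simp: PiE_iff comm_monoid.m_comm intro!: restrict_ext)
  qed
  show "a = b" if eq: "a \<otimes>\<^bsub>P\<^esub> c = b \<otimes>\<^bsub>P\<^esub> c"
    and c: "a \<in> carrier P" "b \<in> carrier P" "c \<in> carrier P" for a b c
  proof (rule PiE_ext[of _ I "\<lambda>i. carrier (D i)"])
    fix i assume i: "i \<in> I"
    have "a i \<otimes>\<^bsub>D i\<^esub> c i = b i \<otimes>\<^bsub>D i\<^esub> c i"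
      using fun_cong[OF eq, of i] i by simp
    then show "a i = b i"
      using monoid_cancel.r_cancel[OF comm_monoid_cancel.axioms(1)[OF factor[OF i]]]
        factor_closed[OF i] c by blast
  qed (use c in auto)
qed

sublocale P: comm_monoid_cancel P
  by (rule product_comm_monoid_cancel)

lemma product_Units_iff:
  assumes "x \<in> carrier P"
  shows "x \<in> Units P \<longleftrightarrow> (\<forall>i\<in>I. x i \<in> Units (D i))"
proof
  assume "x \<in> Units P"
  then obtain y where y: "y \<in> carrier P" "y \<otimes>\<^bsub>P\<^esub> x = \<one>\<^bsub>P\<^esub>" "x \<otimes>\<^bsub>P\<^esub> y = \<one>\<^bsub>P\<^esub>"
    unfolding Units_def by blast
  show "\<forall>i\<in>I. x i \<in> Units (D i)"
  proof
    fix i assume i: "i \<in> I"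
    have "y i \<otimes>\<^bsub>D i\<^esub> x i = \<one>\<^bsub>D i\<^esub>" "x i \<otimes>\<^bsub>D i\<^esub> y i = \<one>\<^bsub>D i\<^esub>"
      using fun_cong[OF y(2), of i] fun_cong[OF y(3), of i] i by simp_all
    then show "x i \<in> Units (D i)"
      unfolding Units_def using factor_closed[OF i] y(1) assms by blast
  qed
next
  assume x: "\<forall>i\<in>I. x i \<in> Units (D i)"
  define y where "y = (\<lambda>i\<in>I. inv\<^bsub>D i\<^esub> x i)"
  have "y \<in> carrier P"
    using x factor_monoid by (auto simp: y_def intro!: monoid.Units_inv_closed)
  moreover have "x \<otimes>\<^bsub>P\<^esub> y = \<one>\<^bsub>P\<^esub>"
    using x factor_monoid by (auto simp: y_def monoid.Units_r_inv intro!: restrict_ext)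
  ultimately show "x \<in> Units P"
    using assms P.m_comm[of x y] unfolding Units_def by auto
qed

definition single :: "'i \<Rightarrow> 'a \<Rightarrow> 'i \<Rightarrow> 'a" where
  "single i x = (\<lambda>j\<in>I. if j = i then x else \<one>\<^bsub>D j\<^esub>)"

lemma single_closed: "\<lbrakk>i \<in> I; x \<in> carrier (D i)\<rbrakk> \<Longrightarrow> single i x \<in> carrier P"
  using factor_monoid by (auto simp: single_def monoid.one_closed)

lemma single_mult:
  assumes "i \<in> I"
  shows "single i (x \<otimes>\<^bsub>D i\<^esub> y) = single i x \<otimes>\<^bsub>P\<^esub> single i y"
  using factor_monoid by (auto simp: single_def monoid.l_one monoid.one_closed)

lemma single_unit: "\<lbrakk>i \<in> I; x \<in> Units (D i)\<rbrakk> \<Longrightarrow> single i x \<in> Units P"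
  using factor_monoid
  by (subst product_Units_iff)
    (auto simp: single_closed single_def monoid.Units_one_closed monoid.Units_closed)

lemma single_Units_iff:
  assumes i: "i \<in> I" and x: "x \<in> carrier (D i)"
  shows "single i x \<in> Units P \<longleftrightarrow> x \<in> Units (D i)"
proof
  assume "single i x \<in> Units P"
  then have "single i x i \<in> Units (D i)"
    using product_Units_iff[OF single_closed[OF i x]] i by blast
  then show "x \<in> Units (D i)" using i by (simp add: single_def)
qed (rule single_unit[OF i])

lemma single_atom:
  assumes i: "i \<in> I" and u: "u \<in> atoms (D i)"
  shows "single i u \<in> atoms P"
proof -
  interpret Di: comm_monoid_cancel "D i" by (rule factor[OF i])
  have uc: "u \<in> carrier (D i)" "u \<notin> Units (D i)" by (rule atoms_closed[OF u], rule atoms_nonunit[OF u])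
  have "x \<in> Units P \<or> y \<in> Units P"
    if xy: "x \<in> carrier P" "y \<in> carrier P" "single i u = x \<otimes>\<^bsub>P\<^esub> y" for x y
  proof -
    have eq: "(if j = i then u else \<one>\<^bsub>D j\<^esub>) = x j \<otimes>\<^bsub>D j\<^esub> y j" if "j \<in> I" for j
      using fun_cong[OF xy(3), of j] that by (simp add: single_def)
    have "x j \<in> Units (D j)" "y j \<in> Units (D j)" if j: "j \<in> I" "j \<noteq> i" for j
    proof -
      interpret Dj: comm_monoid_cancel "D j" by (rule factor[OF j(1)])
      have "x j \<otimes>\<^bsub>D j\<^esub> y j \<in> Units (D j)" using eq[OF j(1)] j(2) Dj.Units_one_closed by simp
      then show "x j \<in> Units (D j)" "y j \<in> Units (D j)"
        using Dj.Units_mult_iff factor_closed[OF j(1)] xy by blast+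
    qed
    moreover have "x i \<in> Units (D i) \<or> y i \<in> Units (D i)"
      using eq[OF i] u factor_closed[OF i] xy Di.atoms_iff by auto
    ultimately show ?thesis
      using product_Units_iff xy by metis
  qed
  then show ?thesis
    using uc single_Units_iff[OF i] single_closed[OF i] by (auto simp: P.atoms_iff nonunits_def)
qed

lemma atom_coordinates:
  assumes u: "u \<in> atoms P"
  shows "\<exists>i\<in>I. u i \<in> atoms (D i) \<and> (\<forall>j\<in>I. j \<noteq> i \<longrightarrow> u j \<in> Units (D j))"
proof -
  have uc: "u \<in> carrier P" "u \<notin> Units P" by (rule atoms_closed[OF u], rule atoms_nonunit[OF u])
  then obtain i where i: "i \<in> I" "u i \<notin> Units (D i)" using product_Units_iff by blast
  interpret Di: comm_monoid_cancel "D i" by (rule factor[OF i(1)])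
  have split: "x i \<in> Units (D i) \<or> (y i \<in> Units (D i) \<and> (\<forall>j\<in>I. j \<noteq> i \<longrightarrow> y j \<in> Units (D j)))"
    if "x \<in> carrier P" "y \<in> carrier P" "u = x \<otimes>\<^bsub>P\<^esub> y" for x y
    using that u i product_Units_iff unfolding P.atoms_iff by metis
  have others: "u j \<in> Units (D j)" if j: "j \<in> I" "j \<noteq> i" for j
  proof -
    define x y where "x = single i (u i)" and "y = u(i := \<one>\<^bsub>D i\<^esub>)"
    have x: "x \<in> carrier P" using single_closed i uc factor_closed by (simp add: x_def)
    have y: "y \<in> carrier P" using uc i by (auto simp: y_def PiE_iff extensional_def)
    have "u = x \<otimes>\<^bsub>P\<^esub> y"
    proof (rule PiE_ext[of _ I "\<lambda>i. carrier (D i)"])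
      fix k assume k: "k \<in> I"
      then show "u k = (x \<otimes>\<^bsub>P\<^esub> y) k"
        using factor_monoid[OF k] factor_closed[OF k uc(1)]
        by (auto simp: x_def y_def single_def monoid.l_one monoid.r_one)
    qed (use uc x y P.m_closed[OF x y] in auto)
    then have "y j \<in> Units (D j)"
      using split[OF x y] i j by (auto simp: x_def single_def)
    then show ?thesis using j by (simp add: y_def)
  qed
  have "v \<in> Units (D i) \<or> w \<in> Units (D i)"
    if vw: "v \<in> carrier (D i)" "w \<in> carrier (D i)" "u i = v \<otimes>\<^bsub>D i\<^esub> w" for v w
  proof -
    define x y where "x = single i v" and "y = u(i := w)"
    have x: "x \<in> carrier P" using single_closed i vw by (simp add: x_def)
    have y: "y \<in> carrier P" using uc i vw by (auto simp: y_def PiE_iff extensional_def)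
    have "u = x \<otimes>\<^bsub>P\<^esub> y"
    proof (rule PiE_ext[of _ I "\<lambda>i. carrier (D i)"])
      fix k assume k: "k \<in> I"
      then show "u k = (x \<otimes>\<^bsub>P\<^esub> y) k"
        using factor_monoid[OF k] factor_closed[OF k uc(1)] vw
        by (auto simp: x_def y_def single_def monoid.l_one)
    qed (use uc x y P.m_closed[OF x y] in auto)
    then show ?thesis
      using split[OF x y] i by (auto simp: x_def y_def single_def)
  qed
  then have "u i \<in> atoms (D i)"
    using i factor_closed[OF i(1) uc(1)] by (auto simp: Di.atoms_iff nonunits_def)
  then show ?thesis using i others by blast
qed

lemma has_length_single:
  assumes "i \<in> I" "has_length (D i) x k"
  shows "has_length P (single i x) k"
  using assms(2)
  by induction
    (auto simp del: mult_product_group simp: single_mult assms(1)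
      intro!: has_length.intros single_unit single_atom assms(1))

lemma has_length_coordinates:
  assumes "has_length P a k"
  shows "\<exists>f. (\<forall>i\<in>I. has_length (D i) (a i) (f i)) \<and> k = (\<Sum>i\<in>I. f i)"
  using assms
proof induction
  case (unit a)
  then have "\<forall>i\<in>I. has_length (D i) (a i) 0"
    using product_Units_iff P.Units_closed by (blast intro: has_length.unit)
  then show ?case by (intro exI[of _ "\<lambda>_. 0"]) simp
next
  case (atom u a k)
  then obtain f where f: "\<forall>i\<in>I. has_length (D i) (a i) (f i)" "k = (\<Sum>i\<in>I. f i)" by blast
  obtain i where i: "i \<in> I" "u i \<in> atoms (D i)" "\<forall>j\<in>I. j \<noteq> i \<longrightarrow> u j \<in> Units (D j)"
    using atom_coordinates[OF atom.hyps(1)] by blast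
  define g where "g = f(i := Suc (f i))"
  have "has_length (D j) (u j \<otimes>\<^bsub>D j\<^esub> a j) (g j)" if j: "j \<in> I" for j
  proof (cases "j = i")
    case True
    then show ?thesis using i f by (auto simp: g_def intro: has_length.atom)
  next
    case False
    have "has_length (D j) (u j) 0" using False i j by (auto intro: has_length.unit)
    then have "has_length (D j) (u j \<otimes>\<^bsub>D j\<^esub> a j) (0 + f j)"
      using comm_monoid_cancel.has_length_mult[OF factor[OF j]] f j by blast
    then show ?thesis using False by (simp add: g_def)
  qed
  moreover have "(\<Sum>i\<in>I. g i) = Suc k"
  proof -
    have "sum g (I - {i}) = sum f (I - {i})" by (intro sum.cong) (auto simp: g_def)
    then show ?thesis
      using f(2) sum.remove[OF finite_index i(1), of f] sum.remove[OF finite_index i(1), of g]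
      by (simp add: g_def)
  qed
  ultimately show ?case by (intro exI[of _ g]) auto
qed

lemma has_length_sum_support:
  assumes "finite J" "J \<subseteq> I" "a \<in> carrier P" "\<forall>i\<in>I - J. a i \<in> Units (D i)"
    "\<forall>i\<in>J. has_length (D i) (a i) (f i)"
  shows "has_length P a (\<Sum>i\<in>J. f i)"
  using assms
proof (induction J arbitrary: a rule: finite_induct)
  case empty
  then have "a \<in> Units P" using product_Units_iff by blast
  then show ?case by (simp add: has_length.unit)
next
  case (insert j J)
  interpret Dj: comm_monoid_cancel "D j" using factor insert.prems by blast
  define b where "b = a(j := \<one>\<^bsub>D j\<^esub>)"
  have j: "j \<in> I" using insert.prems by blast
  have b: "b \<in> carrier P"
    using insert.prems(2) j by (auto simp: b_def PiE_iff extensional_def)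
  have "has_length P b (sum f J)"
  proof (rule insert.IH)
    show "\<forall>i\<in>I - J. b i \<in> Units (D i)" using insert.prems Dj.Units_one_closed by (auto simp: b_def)
    show "\<forall>i\<in>J. has_length (D i) (b i) (f i)" using insert.prems insert.hyps by (auto simp: b_def)
  qed (use insert.prems b in auto)
  moreover have "has_length P (single j (a j)) (f j)"
    using has_length_single j insert.prems by blast
  ultimately have "has_length P (single j (a j) \<otimes>\<^bsub>P\<^esub> b) (f j + sum f J)"
    using P.has_length_mult by blast
  moreover have "single j (a j) \<otimes>\<^bsub>P\<^esub> b = a"
  proof (rule PiE_ext[of _ I "\<lambda>i. carrier (D i)"])
    fix k assume k: "k \<in> I"
    then show "(single j (a j) \<otimes>\<^bsub>P\<^esub> b) k = a k"
      using factor_monoid[OF k] factor_closed[OF k insert.prems(2)]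
      by (auto simp: b_def single_def monoid.l_one monoid.r_one)
  qed (use insert.prems P.m_closed[OF single_closed[OF j factor_closed[OF j insert.prems(2)]] b] in auto)
  ultimately show ?case using insert.hyps by simp
qed

lemma has_length_product_iff:
  assumes "a \<in> carrier P"
  shows "has_length P a k \<longleftrightarrow>
    (\<exists>f. (\<forall>i\<in>I. has_length (D i) (a i) (f i)) \<and> k = (\<Sum>i\<in>I. f i))"
  using has_length_coordinates has_length_sum_support[OF finite_index subset_refl assms] by blast

lemma product_long_progressions:
  assumes "I \<noteq> {}" "\<And>i. i \<in> I \<Longrightarrow> long_progressions (D i)"
  shows "long_progressions P"
  unfolding long_progressions_def
proof
  fix N
  have "\<forall>i\<in>I. \<exists>K. \<forall>a k. has_length (D i) a k \<and> K \<le> k \<longrightarrow>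
     (\<exists>y d. 0 < d \<and> (\<forall>j\<le>N. has_length (D i) a (y + j * d)))"
    using assms(2) unfolding long_progressions_def by blast
  then obtain K where K: "\<And>i a k. i \<in> I \<Longrightarrow> has_length (D i) a k \<Longrightarrow> K i \<le> k \<Longrightarrow>
     \<exists>y d. 0 < d \<and> (\<forall>j\<le>N. has_length (D i) a (y + j * d))"
    by metis
  have "\<exists>y d. 0 < d \<and> (\<forall>j\<le>N. has_length P a (y + j * d))"
    if a: "has_length P a k" "sum K I \<le> k" for a k
  proof -
    obtain f where f: "\<forall>i\<in>I. has_length (D i) (a i) (f i)" "k = sum f I"
      using has_length_coordinates[OF a(1)] by blast
    obtain i where i: "i \<in> I" "K i \<le> f i"
    proof (rule ccontr)
      assume "\<not> thesis"
      then have "\<And>i. i \<in> I \<Longrightarrow> f i < K i" using that not_le by blast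
      then have "sum f I < sum K I" using assms(1) finite_index by (intro sum_strict_mono) auto
      then show False using a f by simp
    qed
    obtain y d where yd: "0 < d" "\<forall>j\<le>N. has_length (D i) (a i) (y + j * d)"
      using K[OF i(1) _ i(2)] f i by blast
    have "has_length P a (y + sum f (I - {i}) + j * d)" if "j \<le> N" for j
    proof -
      define g where "g = f(i := y + j * d)"
      have "sum g (I - {i}) = sum f (I - {i})" by (intro sum.cong) (auto simp: g_def)
      then have "sum g I = y + sum f (I - {i}) + j * d"
        using sum.remove[OF finite_index i(1), of g] by (simp add: g_def)
      moreover have "\<forall>l\<in>I. has_length (D l) (a l) (g l)"
        using f yd that by (auto simp: g_def)
      ultimately show ?thesis
        using has_length_product_iff[OF P.has_length_closed[OF a(1)]] by metis
    qed
    then show ?thesis using yd(1) by blast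
  qed
  then show "\<exists>K. \<forall>a k. has_length P a k \<and> K \<le> k \<longrightarrow>
     (\<exists>y d. 0 < d \<and> (\<forall>j\<le>N. has_length P a (y + j * d)))" by blast
qed

end

section \<open>Local tameness\<close>

context comm_monoid_cancel
begin

abbreviation unit_class :: "'a \<Rightarrow> 'a set" where
  "unit_class a \<equiv> Units G #> a"

lemma mem_unit_class: "b \<in> unit_class a \<longleftrightarrow> (\<exists>e\<in>Units G. b = e \<otimes> a)"
  by (auto simp: r_coset_def)

lemma unit_class_eq_iff:
  assumes "a \<in> carrier G" "b \<in> carrier G"
  shows "unit_class a = unit_class b \<longleftrightarrow> (\<exists>e\<in>Units G. a = e \<otimes> b)"
proof
  assume "unit_class a = unit_class b"
  moreover have "a \<in> unit_class a"
    using assms by (auto simp: mem_unit_class intro!: bexI[of _ \<one>])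
  ultimately show "\<exists>e\<in>Units G. a = e \<otimes> b" by (simp add: mem_unit_class)
next
  assume "\<exists>e\<in>Units G. a = e \<otimes> b"
  then obtain e where e: "e \<in> Units G" "a = e \<otimes> b" by blast
  have "b = inv e \<otimes> a"
    using e assms m_assoc[of "inv e" e b] by (simp add: Units_closed)
  then show "unit_class a = unit_class b"
  proof (intro equalityI subsetI)
    fix x assume "x \<in> unit_class a"
    then obtain f where f: "f \<in> Units G" "x = f \<otimes> a" by (auto simp: mem_unit_class)
    then have "x = (f \<otimes> e) \<otimes> b" using e assms by (simp add: m_assoc Units_closed)
    then show "x \<in> unit_class b" using f e unfolding mem_unit_class by blast
  next
    fix x assume b: "b = inv e \<otimes> a" and "x \<in> unit_class b"
    then obtain f where f: "f \<in> Units G" "x = f \<otimes> b" by (auto simp: mem_unit_class)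
    then have "x = f \<otimes> (inv e \<otimes> a)" using b by simp
    also have "\<dots> = (f \<otimes> inv e) \<otimes> a" using e f assms by (simp add: m_assoc Units_closed)
    finally have "x = (f \<otimes> inv e) \<otimes> a" .
    then show "x \<in> unit_class a" using f e unfolding mem_unit_class by blast
  qed
qed

lemma unit_class_mult:
  assumes "a \<in> carrier G" "b \<in> carrier G"
  shows "unit_class a <#> unit_class b = unit_class (a \<otimes> b)"
proof (intro equalityI subsetI)
  fix x assume "x \<in> unit_class a <#> unit_class b"
  then obtain e f where ef: "e \<in> Units G" "f \<in> Units G" "x = (e \<otimes> a) \<otimes> (f \<otimes> b)"
    by (auto simp: set_mult_def mem_unit_class)
  then have "x = (e \<otimes> f) \<otimes> (a \<otimes> b)"
    using assms by (simp add: m_assoc m_lcomm[of a f b] Units_closed)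
  then show "x \<in> unit_class (a \<otimes> b)" using ef unfolding mem_unit_class by blast
next
  fix x assume "x \<in> unit_class (a \<otimes> b)"
  then obtain e where e: "e \<in> Units G" "x = e \<otimes> (a \<otimes> b)" by (auto simp: mem_unit_class)
  then have "x = (e \<otimes> a) \<otimes> (\<one> \<otimes> b)"
    using assms by (simp add: m_assoc Units_closed)
  moreover have "e \<otimes> a \<in> unit_class a" "\<one> \<otimes> b \<in> unit_class b"
    using e Units_one_closed unfolding mem_unit_class by blast+
  ultimately show "x \<in> unit_class a <#> unit_class b"
    unfolding set_mult_def by blast
qed

lemma unit_class_Units:
  assumes "e \<in> Units G"
  shows "unit_class e = Units G"
proof -
  have "unit_class e = unit_class \<one>"
    using assms by (subst unit_class_eq_iff) (auto intro!: bexI[of _ e] simp: Units_closed)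
  also have "\<dots> = Units G"
    by (auto simp: r_coset_def Units_closed)
  finally show ?thesis .
qed

lemma reduced_simps [simp]:
  "carrier (reduced G) = unit_class ` carrier G"
  "x \<otimes>\<^bsub>reduced G\<^esub> y = x <#> y"
  "\<one>\<^bsub>reduced G\<^esub> = Units G"
  by (auto simp: reduced_def carrier_FactGroup)

lemma Units_reduced_iff:
  assumes "a \<in> carrier G"
  shows "unit_class a \<in> Units (reduced G) \<longleftrightarrow> a \<in> Units G"
proof
  assume "unit_class a \<in> Units (reduced G)"
  then obtain B where "B \<in> carrier (reduced G)" "B <#> unit_class a = Units G"
    unfolding Units_def[of "reduced G"] by auto
  then obtain b where b: "b \<in> carrier G" "unit_class b <#> unit_class a = Units G" by auto
  then have "unit_class (b \<otimes> a) = unit_class \<one>"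
    using assms unit_class_mult unit_class_Units[OF Units_one_closed] by simp
  then have "b \<otimes> a \<in> Units G"
    using assms b(1) unit_class_eq_iff[of "b \<otimes> a" \<one>] Units_closed by force
  then show "a \<in> Units G" using assms b(1) Units_mult_iff by blast
next
  assume a: "a \<in> Units G"
  have "Units G <#> Units G = Units G"
    using unit_class_mult[of \<one> \<one>] unit_class_Units[OF Units_one_closed] by simp
  moreover have "Units G \<in> unit_class ` carrier G"
    using unit_class_Units[OF Units_one_closed] by blast
  ultimately show "unit_class a \<in> Units (reduced G)"
    using a Units_one_closed unit_class_Units
    by (auto simp: Units_def[of "reduced G"] intro!: bexI[of _ \<one>])
qed

lemma unit_class_divides_iff:
  assumes "a \<in> carrier G" "b \<in> carrier G"
  shows "unit_class a divides\<^bsub>reduced G\<^esub> unit_class b \<longleftrightarrow> a divides b"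
proof
  assume "unit_class a divides\<^bsub>reduced G\<^esub> unit_class b"
  then obtain c where c: "c \<in> carrier G" "unit_class b = unit_class (a \<otimes> c)"
    using assms unfolding factor_def by (auto simp: unit_class_mult)
  then obtain e where e: "e \<in> Units G" "b = e \<otimes> (a \<otimes> c)"
    using assms unit_class_eq_iff by blast
  then have "b = a \<otimes> (e \<otimes> c)"
    using assms c(1) by (simp add: m_lcomm Units_closed)
  then show "a divides b" using c e unfolding factor_def by (blast intro: Units_closed m_closed)
next
  assume "a divides b"
  then obtain c where "c \<in> carrier G" "b = a \<otimes> c" unfolding factor_def by blast
  then show "unit_class a divides\<^bsub>reduced G\<^esub> unit_class b"
    using assms unfolding factor_def by (auto simp: unit_class_mult)
qed

lemma unit_class_atom_iff:
  assumes "a \<in> carrier G"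
  shows "unit_class a \<in> atoms (reduced G) \<longleftrightarrow> a \<in> atoms G"
proof -
  have "properfactor (reduced G) (unit_class b) (unit_class a) \<longleftrightarrow> properfactor G b a"
    if "b \<in> carrier G" for b
    using that assms by (simp add: properfactor_def unit_class_divides_iff)
  then show ?thesis
    using assms by (simp add: atoms_def irreducible_def Units_reduced_iff)
qed

lemma list_prod_unit_class:
  "set us \<subseteq> carrier G \<Longrightarrow>
    list_prod (reduced G) (map unit_class us) = unit_class (list_prod G us)"
  by (induction us) (simp_all add: unit_class_mult unit_class_Units)

lemma reduced_atoms_list:
  "set ws \<subseteq> atoms (reduced G) \<Longrightarrow> \<exists>xs. set xs \<subseteq> atoms G \<and> ws = map unit_class xs"
proof (induction ws)
  case (Cons w ws)
  then obtain xs where xs: "set xs \<subseteq> atoms G" "ws = map unit_class xs" by auto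
  have "w \<in> carrier (reduced G)" "w \<in> atoms (reduced G)"
    using Cons.prems atoms_closed[of w "reduced G"] by auto
  then obtain x where "x \<in> carrier G" "w = unit_class x" "x \<in> atoms G"
    using unit_class_atom_iff by auto
  then show ?case using xs by (intro exI[of _ "x # xs"]) auto
qed simp

lemma factorization_of_atoms:
  assumes "set us \<subseteq> atoms G" "e \<in> Units G"
  shows "mset (map unit_class us) \<in> factorizations G (list_prod G us \<otimes> e)"
proof -
  have sub: "set us \<subseteq> carrier G" using assms by (blast intro: atoms_closed)
  have "unit_class (list_prod G us \<otimes> e) = unit_class (list_prod G us)"
    using assms(2) sub m_comm[of e "list_prod G us"]
    by (subst unit_class_eq_iff) (simp_all add: Units_closed, metis)
  moreover have "set (map unit_class us) \<subseteq> atoms (reduced G)"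
    using assms(1) sub unit_class_atom_iff by auto
  ultimately show ?thesis
    using list_prod_unit_class[OF sub]
    unfolding factorizations_def factorization_monoid_def free_abelian_monoid_def
    by (intro CollectI exI[of _ "map unit_class us"]) auto
qed

definition length_tame :: "'a \<Rightarrow> nat \<Rightarrow> bool" where
  "length_tame c T \<longleftrightarrow> (\<forall>a\<in>carrier G. \<forall>k. has_length G (c \<otimes> a) k \<longrightarrow>
     (\<exists>l. has_length G a l \<and> k \<le> l + T \<and> l \<le> k + T))"

lemma length_le_fact_dist: "size z \<le> size z' + fact_dist z z'"
proof -
  have "size z = size (z - z \<inter># z') + size (z \<inter># z')"
    by (metis size_union subset_mset.diff_add subset_mset.inf_le1)
  moreover have "size (z \<inter># z') \<le> size z'" by (simp add: size_mset_mono)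
  ultimately show ?thesis by (simp add: fact_dist_def Let_def)
qed

lemma length_le_fact_dist': "size z' \<le> size z + fact_dist z z'"
  using length_le_fact_dist[of z' z] by (simp add: fact_dist_def Let_def inf.commute max.commute)

lemma locally_tame_atom:
  assumes "locally_tame G" "u \<in> atoms G"
  shows "\<exists>T. length_tame u T"
proof -
  define Q where "Q = (\<lambda>N. \<forall>a\<in>carrier G.
        factorizations G a \<inter> add_mset (unit_class u) ` carrier (factorization_monoid G) \<noteq> {} \<longrightarrow>
        (\<forall>z\<in>factorizations G a.
           \<exists>z'\<in>factorizations G a \<inter> add_mset (unit_class u) ` carrier (factorization_monoid G).
             enat (fact_dist z z') \<le> N))"
  have uc: "u \<in> carrier G" using assms by (blast intro: atoms_closed)
  have deg: "local_tame_degree G (unit_class u) = (LEAST N. Q N)"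
    by (simp add: local_tame_degree_def Q_def)
  have "Q \<infinity>" unfolding Q_def by auto
  then have "Q (local_tame_degree G (unit_class u))" unfolding deg by (rule LeastI)
  moreover have "local_tame_degree G (unit_class u) < \<infinity>"
    using assms unit_class_atom_iff[OF uc] by (simp add: locally_tame_def)
  ultimately obtain t where t: "Q (enat t)" by (metis enat_ord_simps(4) not_infinity_eq)
  have "\<exists>l. has_length G a l \<and> k \<le> l + Suc t \<and> l \<le> k + Suc t"
    if a: "a \<in> carrier G" and k: "has_length G (u \<otimes> a) k" for a k
  proof -
    let ?Z = "factorizations G (u \<otimes> a)"
    let ?uZ = "add_mset (unit_class u) ` carrier (factorization_monoid G)"
    obtain us e where us: "e \<in> Units G" "length us = k" "set us \<subseteq> atoms G"
      "u \<otimes> a = list_prod G us \<otimes> e"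
      using has_length_imp_list[OF k] by blast
    obtain m where "has_length G a m" using assms(1) a atomic_iff by (auto simp: locally_tame_def)
    then obtain vs f where vs: "f \<in> Units G" "set vs \<subseteq> atoms G" "a = list_prod G vs \<otimes> f"
      using has_length_imp_list by blast
    have vc: "set vs \<subseteq> carrier G" using vs(2) by (blast intro: atoms_closed)
    have "u \<otimes> a = list_prod G (u # vs) \<otimes> f"
      using uc vs vc by (simp add: m_assoc Units_closed)
    then have "mset (map unit_class (u # vs)) \<in> ?Z"
      using factorization_of_atoms[of "u # vs" f] vs assms(2) by simp
    moreover have "mset (map unit_class vs) \<in> carrier (factorization_monoid G)"
      using vs(2) vc unit_class_atom_iff
      by (auto simp: factorization_monoid_def free_abelian_monoid_def)
    then have "mset (map unit_class (u # vs)) \<in> ?uZ" by simp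
    ultimately have ne: "?Z \<inter> ?uZ \<noteq> {}" by blast
    have "mset (map unit_class us) \<in> ?Z"
      using factorization_of_atoms[OF us(3,1)] us(4) by simp
    then have "\<exists>z'\<in>?Z \<inter> ?uZ. enat (fact_dist (mset (map unit_class us)) z') \<le> enat t"
      by (rule t[unfolded Q_def, rule_format, OF m_closed[OF uc a] ne])
    then obtain z' where z': "z' \<in> ?Z" "z' \<in> ?uZ"
      "fact_dist (mset (map unit_class us)) z' \<le> t"
      by (elim bexE IntE) (simp only: enat_ord_simps)
    obtain ws where ws: "z' = mset ws" "set ws \<subseteq> atoms (reduced G)"
      "list_prod (reduced G) ws = unit_class (u \<otimes> a)"
      using z'(1) by (auto simp: factorizations_def factorization_monoid_def free_abelian_monoid_def)
    obtain xs where xs: "set xs \<subseteq> atoms G" "ws = map unit_class xs"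
      using reduced_atoms_list[OF ws(2)] by blast
    have "unit_class u \<in># z'" using z'(2) by auto
    then obtain x where x: "x \<in> set xs" "unit_class x = unit_class u"
      using ws xs by auto
    then obtain as bs where split: "xs = as @ x # bs" by (meson split_list)
    have c: "set as \<subseteq> atoms G" "set bs \<subseteq> atoms G" "set as \<subseteq> carrier G" "set bs \<subseteq> carrier G"
      "x \<in> carrier G" "set xs \<subseteq> carrier G"
      using xs(1) split by (auto intro: atoms_closed)
    obtain g where g: "g \<in> Units G" "x = g \<otimes> u"
      using x(2) unit_class_eq_iff[OF c(5) uc] by blast
    have "unit_class (list_prod G xs) = unit_class (u \<otimes> a)"
      using ws(3) xs(2) list_prod_unit_class c by simp
    then obtain h where h: "h \<in> Units G" "list_prod G xs = h \<otimes> (u \<otimes> a)"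
      using unit_class_eq_iff[of "list_prod G xs" "u \<otimes> a"] c(6) uc a by auto
    define p where "p = list_prod G (as @ bs)"
    have p: "p \<in> carrier G" "has_length G p (length (as @ bs))"
      using c has_length_list_prod[of "as @ bs"] by (auto simp: p_def)
    have "u \<otimes> (g \<otimes> p) = x \<otimes> p"
      using g p uc by (simp add: m_assoc m_lcomm Units_closed)
    also have "\<dots> = list_prod G xs"
      using c(3-5) by (simp add: split p_def list_prod_append m_lcomm)
    also have "\<dots> = u \<otimes> (h \<otimes> a)" using h uc a by (simp add: m_lcomm Units_closed)
    finally have "g \<otimes> p = h \<otimes> a"
      using l_cancel[of u "g \<otimes> p" "h \<otimes> a"] uc a p g(1) h(1) by (simp add: Units_closed)
    then have "a = inv h \<otimes> (g \<otimes> p)"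
      using h(1) a m_assoc[of "inv h" h a] by (simp add: Units_closed)
    moreover have "has_length G (inv h \<otimes> (g \<otimes> p)) (0 + (0 + length (as @ bs)))"
      using p g(1) h(1) by (intro has_length_mult) (auto intro: has_length.unit)
    ultimately have "has_length G a (length (as @ bs))" by simp
    moreover have "size z' = Suc (length (as @ bs))" "size (mset (map unit_class us)) = k"
      using ws xs split us by auto
    moreover have "size (mset (map unit_class us)) \<le> size z' + t"
      "size z' \<le> size (mset (map unit_class us)) + t"
      using z'(3) length_le_fact_dist[of "mset (map unit_class us)" z']
        length_le_fact_dist'[of z' "mset (map unit_class us)"] by linarith+
    ultimately show ?thesis by (intro exI[of _ "length (as @ bs)"]) auto
  qed
  then show ?thesis unfolding length_tame_def by blast
qed

lemma locally_tame_length_tame: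
  assumes "locally_tame G" "c \<in> carrier G"
  shows "\<exists>T. length_tame c T"
proof -
  obtain n where "has_length G c n" using assms atomic_iff by (auto simp: locally_tame_def)
  then show ?thesis
  proof induction
    case (unit c)
    have "has_length G a k" if a: "a \<in> carrier G" "has_length G (c \<otimes> a) k" for a k
    proof -
      have "has_length G (inv c \<otimes> (c \<otimes> a)) (0 + k)"
        using unit a by (intro has_length_mult) (auto intro: has_length.unit)
      moreover have "inv c \<otimes> (c \<otimes> a) = a"
        using unit a(1) m_assoc[of "inv c" c a] by (simp add: Units_closed)
      ultimately show ?thesis by simp
    qed
    then have "length_tame c 0" by (auto simp: length_tame_def)
    then show ?case by blast
  next
    case (atom u c n)
    obtain S where S: "length_tame u S" using locally_tame_atom[OF assms(1) atom.hyps(1)] by blast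
    obtain T where T: "length_tame c T" using atom.IH by blast
    have cl: "u \<in> carrier G" "c \<in> carrier G"
      using atom.hyps has_length_closed by (auto intro: atoms_closed)
    have "length_tame (u \<otimes> c) (S + T)"
      unfolding length_tame_def
    proof (intro ballI allI impI)
      fix a k assume a: "a \<in> carrier G" "has_length G (u \<otimes> c \<otimes> a) k"
      then have "has_length G (u \<otimes> (c \<otimes> a)) k" using cl by (simp add: m_assoc)
      then obtain l where l: "has_length G (c \<otimes> a) l" "k \<le> l + S" "l \<le> k + S"
        using S a cl unfolding length_tame_def by blast
      then obtain m where "has_length G a m" "l \<le> m + T" "m \<le> l + T"
        using T a unfolding length_tame_def by blast
      then show "\<exists>l. has_length G a l \<and> k \<le> l + (S + T) \<and> l \<le> k + (S + T)"
        using l by (intro exI[of _ m]) auto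
    qed
    then show ?case by blast
  qed
qed

text \<open>
  A large gap in the set of lengths of a multiple of \<open>u\<close> survives the division by \<open>u\<close>, so it is
  found in an element not divisible by \<open>u\<close>, all of whose lengths are less than \<open>K\<close>.
\<close>

lemma gap_bound:
  assumes u: "u \<in> atoms G" and t: "length_tame u t"
    and K: "\<And>a k. has_length G a k \<Longrightarrow> K \<le> k \<Longrightarrow> \<exists>b\<in>carrier G. a = u \<otimes> b"
    and "\<And>k. has_length G a k \<Longrightarrow> k \<le> B"
    and "has_length G a x" "x \<le> X" "has_length G a y" "Y \<le> y"
    and "\<And>k. has_length G a k \<Longrightarrow> k \<le> X \<or> Y \<le> k"
  shows "Y \<le> X + (K + t + 1)"
  using assms(4-)
proof (induction B arbitrary: a x X y Y)
  case 0
  then have "y = 0" by force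
  then show ?case using 0 by simp
next
  case (Suc B)
  show ?case
  proof (rule ccontr)
    assume gap: "\<not> Y \<le> X + (K + t + 1)"
    then have "K \<le> y" using Suc.prems by linarith
    then obtain b where b: "b \<in> carrier G" "a = u \<otimes> b" using K Suc.prems by blast
    have up: "has_length G a (Suc k)" if "has_length G b k" for k
      using has_length.atom[OF u that] b by simp
    obtain x' where x': "has_length G b x'" "x' \<le> x + t"
      using t b Suc.prems(2) unfolding length_tame_def by blast
    obtain y' where y': "has_length G b y'" "y \<le> y' + t"
      using t b Suc.prems(4) unfolding length_tame_def by blast
    have "Suc x' \<le> X" using Suc.prems(6)[OF up[OF x'(1)]] x' gap Suc.prems(3) by linarith
    moreover have "Y \<le> Suc y'" using Suc.prems(6)[OF up[OF y'(1)]] y' gap Suc.prems(5) by linarith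
    ultimately have "Y - 1 \<le> (X - 1) + (K + t + 1)"
    proof (intro Suc.IH[of b x' "X - 1" y' "Y - 1"])
      show "k \<le> X - 1 \<or> Y - 1 \<le> k" if "has_length G b k" for k
        using Suc.prems(6)[OF up[OF that]] by linarith
      show "k \<le> B" if "has_length G b k" for k
        using Suc.prems(1)[OF up[OF that]] by simp
    qed (use x' y' in auto)
    then show False using gap \<open>Suc x' \<le> X\<close> by linarith
  qed
qed

definition length_difference :: "nat \<Rightarrow> bool" where
  "length_difference d \<longleftrightarrow> 0 < d \<and> (\<exists>c p. has_length G c p \<and> has_length G c (p + d))"

lemma least_difference_dvd:
  assumes "length_difference d" "\<And>e. length_difference e \<Longrightarrow> d \<le> e"
    and a: "has_length G a k" "has_length G a l"
  shows "int d dvd int l - int k"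
proof -
  have *: "d dvd l - k" if "k \<le> l" "has_length G a k" "has_length G a l" for k l
  proof (rule ccontr)
    assume nd: "\<not> d dvd l - k"
    define s r where "s = (l - k) div d" and "r = (l - k) mod d"
    have d: "0 < d" using assms(1) by (simp add: length_difference_def)
    then have r: "0 < r" "r < d" using nd by (auto simp: r_def mod_greater_zero_iff_not_dvd)
    have lk: "l = k + s * d + r" using that(1) by (simp add: s_def r_def)
    obtain c p where c: "has_length G c p" "has_length G c (p + d)"
      using assms(1) by (auto simp: length_difference_def)
    have "has_length G (a \<otimes> c [^] s) (k + (s * p + s * d))"
      using that c by (intro has_length_mult has_length_pow_progression) auto
    moreover have "has_length G (a \<otimes> c [^] s) (l + (s * p + 0 * d))"
      using that c by (intro has_length_mult has_length_pow_progression) auto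
    then have "has_length G (a \<otimes> c [^] s) (k + (s * p + s * d) + r)"
      by (simp add: lk ac_simps)
    ultimately have "length_difference r" using r unfolding length_difference_def by blast
    then show False using assms(2) r by fastforce
  qed
  show ?thesis
  proof (cases "k \<le> l")
    case True
    then have "int d dvd int (l - k)" using * a by (simp only: int_dvd_int_iff)
    then show ?thesis using True by (simp add: of_nat_diff)
  next
    case False
    then have "int d dvd int (k - l)" using * a by (simp only: int_dvd_int_iff nat_le_linear)
    then show ?thesis using False by (simp add: of_nat_diff dvd_diff_commute)
  qed
qed

end

lemma central_periodic_lengths:
  assumes sp: "strongly_primary H" and tame: "locally_tame H" and nhf: "\<not> half_factorial H"
  shows "\<exists>d M. 0 < d \<and>
    (\<forall>a\<in>carrier H. central_periodic d M (int ` {k. has_length H a k}))"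
proof -
  interpret comm_monoid_cancel H
    using sp by (simp add: strongly_primary_def)
  obtain d where d: "length_difference d" "\<And>e. length_difference e \<Longrightarrow> d \<le> e"
  proof -
    have "\<exists>d. length_difference d"
      using not_half_factorial_witness[OF sp nhf] unfolding length_difference_def by blast
    then have "length_difference (LEAST d. length_difference d)" by (rule LeastI_ex)
    then show ?thesis using that Least_le by metis
  qed
  obtain c p where c: "has_length H c p" "has_length H c (p + d)" and d0: "0 < d"
    using d(1) unfolding length_difference_def by blast
  have nu: "c \<notin> Units H"
    using has_length_Units[OF c(1)] has_length_Units[OF c(2)] d0 by fastforce
  obtain u where u: "u \<in> atoms H"
    using c(1) nu by cases auto
  have uc: "u \<in> carrier H" by (rule atoms_closed[OF u])
  obtain t where t: "length_tame u t" using locally_tame_length_tame[OF tame uc] by blast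
  obtain Ku where Ku: "\<And>a k. has_length H a k \<Longrightarrow> Ku \<le> k \<Longrightarrow> \<exists>b\<in>carrier H. a = u \<otimes>\<^bsub>H\<^esub> b"
    using strongly_primary_dvd_long[OF sp uc] by blast
  define g where "g = Ku + t + 1"
  define e where "e = c [^]\<^bsub>H\<^esub> g"
  have ec: "e \<in> carrier H" using has_length_closed[OF c(1)] by (simp add: e_def)
  obtain T where T: "length_tame e T" using locally_tame_length_tame[OF tame ec] by blast
  obtain K where K: "\<And>a k. has_length H a k \<Longrightarrow> K \<le> k \<Longrightarrow> \<exists>b\<in>carrier H. a = e \<otimes>\<^bsub>H\<^esub> b"
    using strongly_primary_dvd_long[OF sp ec] by blast
  define M where "M = K + T + g * p + 1"
  have fill: "has_length H a y"
    if x: "has_length H a x" "has_length H a r" "has_length H a s"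
      and y: "int d dvd int y - int x" "r + M \<le> y" "y + M \<le> s" for a x r s y
  proof -
    obtain b where b: "b \<in> carrier H" "a = e \<otimes>\<^bsub>H\<^esub> b"
      using K[OF x(3)] y by (auto simp: M_def)
    have up: "has_length H a (k + g * p + j * d)" if "has_length H b k" "j \<le> g" for k j
      using has_length_mult[OF has_length_pow_progression[OF c that(2)] that(1)]
      by (simp add: b(2) e_def ac_simps)
    obtain r' where r': "has_length H b r'" "r' \<le> r + T"
      using T b x(2) unfolding length_tame_def by blast
    obtain s' where s': "has_length H b s'" "s \<le> s' + T"
      using T b x(3) unfolding length_tame_def by blast
    have fin: "finite {k. has_length H b k}" by (rule strongly_primary_finite_lengths[OF sp b(1)])
    define W where "W = {k. has_length H b k \<and> k + g * p \<le> y}"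
    have "finite W" using fin by (rule rev_finite_subset) (auto simp: W_def)
    moreover have "r' \<in> W" using r' y by (auto simp: W_def M_def)
    ultimately have "Max W \<in> W" and Max: "\<And>k. k \<in> W \<Longrightarrow> k \<le> Max W"
      by (blast intro: Max_in Max_ge)+
    define w where "w = Max W"
    have w: "has_length H b w" "w + g * p \<le> y" using \<open>Max W \<in> W\<close> by (auto simp: w_def W_def)
    have gap: "k \<le> w \<or> y + 1 - g * p \<le> k" if "has_length H b k" for k
      using Max[of k] that by (force simp: W_def w_def)
    have "y + 1 - g * p \<le> w + g"
      unfolding g_def
    proof (rule gap_bound[OF u t Ku])
      show "k \<le> Max {k. has_length H b k}" if "has_length H b k" for k
        using that fin by auto
      show "y + 1 - (Ku + t + 1) * p \<le> s'" using s' y(3) by (simp add: M_def)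
      show "k \<le> w \<or> y + 1 - (Ku + t + 1) * p \<le> k" if "has_length H b k" for k
        using gap[OF that] by (simp add: g_def)
    qed (use w s' in auto)
    then have near: "y \<le> w + g * p + g" by linarith
    have "int d dvd int (w + g * p) - int x"
      by (rule least_difference_dvd[OF d x(1)]) (use up[OF w(1), of 0] in simp_all)
    then have "int d dvd (int y - int x) - (int (w + g * p) - int x)"
      using y(1) by (rule dvd_diff[rotated])
    moreover have "int (y - (w + g * p)) = (int y - int x) - (int (w + g * p) - int x)"
      using w(2) by (simp add: of_nat_diff)
    ultimately have "int d dvd int (y - (w + g * p))" by (simp only:)
    then have "d dvd y - (w + g * p)" by (simp only: int_dvd_int_iff)
    then obtain j where "y - (w + g * p) = d * j" by (rule dvdE)
    then have j: "y = w + g * p + j * d" using w(2) by (simp add: mult.commute)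
    then have "j * d \<le> g" using near by linarith
    moreover have "j * 1 \<le> j * d" using d0 by (intro mult_le_mono2) simp
    ultimately have "j \<le> g" by linarith
    then show ?thesis using up[OF w(1)] j by simp
  qed
  have "central_periodic d M (int ` {k. has_length H a k})" for a
    unfolding central_periodic_def
  proof (intro ballI allI impI, elim conjE)
    fix x r s y
    assume *: "x \<in> int ` {k. has_length H a k}" "r \<in> int ` {k. has_length H a k}"
      "s \<in> int ` {k. has_length H a k}" "int d dvd y - x" "r + int M \<le> y" "y + int M \<le> s"
    then have "0 \<le> y" by auto
    then obtain n where n: "y = int n" by (rule nonneg_int_cases)
    obtain x' r' s' where nat: "x = int x'" "r = int r'" "s = int s'"
      and len: "has_length H a x'" "has_length H a r'" "has_length H a s'"
      using *(1-3) by blast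
    have "has_length H a n"
      by (rule fill[OF len]) (use *(4-6) nat n in simp_all)
    then show "y \<in> int ` {k. has_length H a k}" using n by blast
  qed
  then show ?thesis using d0 by blast
qed

section \<open>Weak transfer homomorphisms and zero-sum sequences\<close>

lemma weak_transfer_hom_lengths:
  assumes H: "comm_monoid_cancel H" and B: "comm_monoid_cancel B" "atomic B" "Units B = {\<one>\<^bsub>B\<^esub>}"
    and w: "weak_transfer_hom H B \<theta>" and a: "a \<in> carrier H"
  shows "set_of_lengths H a = set_of_lengths B (\<theta> a)"
proof -
  interpret H: comm_monoid_cancel H by fact
  interpret B: comm_monoid_cancel B by fact
  have hom: "\<theta> (x \<otimes>\<^bsub>H\<^esub> y) = \<theta> x \<otimes>\<^bsub>B\<^esub> \<theta> y" if "x \<in> carrier H" "y \<in> carrier H" for x y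
    using w that by (simp add: weak_transfer_hom_def hom_def)
  have one: "\<theta> \<one>\<^bsub>H\<^esub> = \<one>\<^bsub>B\<^esub>" using w by (simp add: weak_transfer_hom_def)
  have closed: "\<theta> x \<in> carrier B" if "x \<in> carrier H" for x
    using w that by (auto simp: weak_transfer_hom_def hom_def)
  have unit: "\<theta> x \<in> Units B \<longleftrightarrow> x \<in> Units H" if "x \<in> carrier H" for x
  proof -
    have "{a \<in> carrier H. \<theta> a = \<one>\<^bsub>B\<^esub>} = Units H" using w by (simp add: weak_transfer_hom_def)
    then show ?thesis using that B(3) by blast
  qed
  have lift: "\<exists>us. length us = length vs \<and> set us \<subseteq> atoms H \<and> x = list_prod H us"
    if "x \<in> carrier H" "vs \<noteq> []" "set vs \<subseteq> atoms B" "\<theta> x = list_prod B vs" for x vs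
    using w that unfolding weak_transfer_hom_def by metis
  have prod: "\<theta> (list_prod H us) = list_prod B (map \<theta> us)" if "set us \<subseteq> carrier H" for us
    using that by (induction us) (simp_all add: one hom)
  have atom: "\<theta> u \<in> atoms B" if u: "u \<in> atoms H" for u
  proof -
    have uc: "u \<in> carrier H" "u \<notin> Units H" by (rule atoms_closed[OF u], rule atoms_nonunit[OF u])
    then have "\<theta> u \<in> nonunits B" using closed unit by (simp add: nonunits_def)
    then obtain vs where vs: "set vs \<subseteq> atoms B" "list_prod B vs = \<theta> u"
      using B(2) unfolding atomic_def by blast
    have "vs \<noteq> []"
    proof
      assume "vs = []"
      then have "\<theta> u \<in> Units B" using vs(2) B.Units_one_closed by simp
      then show False using uc unit by blast
    qed
    then obtain us where us: "length us = length vs" "set us \<subseteq> atoms H" "u = list_prod H us"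
      using lift[OF uc(1) _ vs(1)] vs(2) by metis
    then obtain x xs where xs: "us = x # xs" using \<open>vs \<noteq> []\<close> by (cases us) auto
    have sub: "set xs \<subseteq> atoms H" "set xs \<subseteq> carrier H" "x \<in> carrier H" "x \<notin> Units H"
      using us(2) xs by (auto intro: atoms_closed dest: atoms_nonunit)
    have "u = x \<otimes>\<^bsub>H\<^esub> list_prod H xs" using us xs by simp
    then have "list_prod H xs \<in> Units H"
      using u sub H.atoms_iff H.list_prod_closed by blast
    then have "length xs = 0"
      using H.has_length_Units[OF H.has_length_list_prod[OF sub(1)]] by blast
    then obtain v where v: "vs = [v]" using us(1) xs by (cases vs) auto
    then have "v \<in> atoms B" using vs(1) by simp
    moreover have "\<theta> u = v" using vs(2) v atoms_closed[OF \<open>v \<in> atoms B\<close>] by simp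
    ultimately show ?thesis by simp
  qed
  show ?thesis
  proof (cases "a \<in> Units H")
    case False
    have "(\<exists>us. length us = k \<and> set us \<subseteq> atoms H \<and> list_prod H us = a) \<longleftrightarrow>
        (\<exists>vs. length vs = k \<and> set vs \<subseteq> atoms B \<and> list_prod B vs = \<theta> a)" if k: "0 < k" for k
    proof
      assume "\<exists>us. length us = k \<and> set us \<subseteq> atoms H \<and> list_prod H us = a"
      then obtain us where us: "length us = k" "set us \<subseteq> atoms H" "list_prod H us = a" by blast
      then have "set us \<subseteq> carrier H" by (blast intro: atoms_closed)
      then have "list_prod B (map \<theta> us) = \<theta> a" using prod us by metis
      moreover have "set (map \<theta> us) \<subseteq> atoms B" using us atom by auto
      ultimately show "\<exists>vs. length vs = k \<and> set vs \<subseteq> atoms B \<and> list_prod B vs = \<theta> a"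
        using us(1) by (intro exI[of _ "map \<theta> us"]) simp
    next
      assume "\<exists>vs. length vs = k \<and> set vs \<subseteq> atoms B \<and> list_prod B vs = \<theta> a"
      then obtain vs where vs: "length vs = k" "set vs \<subseteq> atoms B" "list_prod B vs = \<theta> a" by blast
      then have "vs \<noteq> []" using k by auto
      then show "\<exists>us. length us = k \<and> set us \<subseteq> atoms H \<and> list_prod H us = a"
        using lift[OF a _ vs(2)] vs by metis
    qed
    then show ?thesis
      using False unit[OF a] by (auto simp: set_of_lengths_def)
  qed (use unit[OF a] in \<open>simp add: set_of_lengths_def\<close>)
qed

lemma weak_transfer_hom_system:
  assumes "comm_monoid_cancel H" "comm_monoid_cancel B" "atomic B" "Units B = {\<one>\<^bsub>B\<^esub>}"
    "weak_transfer_hom H B \<theta>"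
  shows "system_of_lengths H = system_of_lengths B"
proof -
  have "\<theta> ` carrier H = carrier B" using assms(5) by (simp add: weak_transfer_hom_def)
  then show ?thesis
    using weak_transfer_hom_lengths[OF assms]
    by (auto simp: system_of_lengths_def simp flip: \<open>\<theta> ` carrier H = carrier B\<close>)
qed

lemma zero_sum_monoid_simps [simp]:
  "x \<otimes>\<^bsub>zero_sum_monoid G G0\<^esub> y = x + y"
  "\<one>\<^bsub>zero_sum_monoid G G0\<^esub> = {#}"
  by (simp_all add: zero_sum_monoid_def free_abelian_monoid_def)

lemma carrier_zero_sum_monoid:
  "carrier (zero_sum_monoid G G0) = {mset gs | gs. set gs \<subseteq> G0 \<and> list_prod G gs = \<one>\<^bsub>G\<^esub>}"
  by (simp add: zero_sum_monoid_def)

locale zero_sum = comm_group +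
  fixes G0
  assumes subset: "G0 \<subseteq> carrier G"
begin

abbreviation B where "B \<equiv> zero_sum_monoid G G0"

lemma empty_closed: "{#} \<in> carrier B"
  unfolding carrier_zero_sum_monoid by (intro CollectI exI[of _ "[]"]) simp

lemma add_closed:
  assumes "x \<in> carrier B" "y \<in> carrier B"
  shows "x + y \<in> carrier B"
proof -
  obtain gs hs where "x = mset gs" "set gs \<subseteq> G0" "list_prod G gs = \<one>"
    "y = mset hs" "set hs \<subseteq> G0" "list_prod G hs = \<one>"
    using assms unfolding carrier_zero_sum_monoid by blast
  then show ?thesis
    unfolding carrier_zero_sum_monoid
    using subset by (intro CollectI exI[of _ "gs @ hs"]) (simp add: list_prod_append)
qed

lemma cancel_closed:
  assumes "x \<in> carrier B" "x + y \<in> carrier B"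
  shows "y \<in> carrier B"
proof -
  obtain gs hs where *: "x = mset gs" "set gs \<subseteq> G0" "list_prod G gs = \<one>"
    "x + y = mset hs" "set hs \<subseteq> G0" "list_prod G hs = \<one>"
    using assms unfolding carrier_zero_sum_monoid by blast
  obtain ks where ks: "y = mset ks" by (metis ex_mset)
  have eq: "mset hs = mset (gs @ ks)" using * ks by simp
  then have sub: "set ks \<subseteq> G0" using *(5) mset_eq_setD[OF eq] by simp
  have "list_prod G hs = list_prod G (gs @ ks)"
    using eq *(5) subset by (intro list_prod_mset_cong) auto
  also have "\<dots> = list_prod G ks"
    using * sub subset by (simp add: list_prod_append)
  finally show ?thesis
    unfolding carrier_zero_sum_monoid using *(6) ks sub by auto
qed

lemma repeat_closed: "x \<in> carrier B \<Longrightarrow> repeat_mset n x \<in> carrier B"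
  by (induction n) (auto simp: empty_closed add_closed)

lemma comm_monoid_cancel_B: "comm_monoid_cancel B"
  by (intro comm_monoid_cancelI comm_monoidI) (auto simp: empty_closed add_closed)

sublocale B: comm_monoid_cancel B
  by (rule comm_monoid_cancel_B)

lemma Units_B: "Units B = {{#}}"
  using empty_closed by (auto simp: Units_def)

lemma list_prod_B_size: "set xs \<subseteq> nonunits B \<Longrightarrow> length xs \<le> size (list_prod B xs)"
proof (induction xs)
  case (Cons x xs)
  then have "0 < size x" by (simp add: nonunits_def Units_B nonempty_has_size)
  then show ?case using Cons by simp
qed simp

lemma atomic_B: "atomic B"
  unfolding B.atomic_iff
proof
  fix z assume z: "z \<in> carrier B"
  have "B.BF_element z (size z)"
    using list_prod_B_size by (auto simp: B.BF_element_def)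
  then show "\<exists>k. has_length B z k" by (rule B.BF_element_has_length[OF z])
qed

lemma minimal_support_powers:
  assumes v: "v \<in> carrier B" "v \<noteq> {#}"
    and supp: "\<And>w. w \<in> carrier B \<Longrightarrow> w \<noteq> {#} \<Longrightarrow> card (set_mset v) \<le> card (set_mset w)"
    and size: "\<And>w. w \<in> carrier B \<Longrightarrow> w \<noteq> {#} \<Longrightarrow> set_mset w = set_mset v \<Longrightarrow> size v \<le> size w"
    and w: "w \<in> carrier B" "set_mset w \<subseteq> set_mset v"
  shows "\<exists>j. w = repeat_mset j v"
  using w
proof (induction "size w" arbitrary: w rule: less_induct)
  case less
  have eq_supp: "set_mset x = set_mset v" if "x \<in> carrier B" "x \<noteq> {#}" "set_mset x \<subseteq> set_mset v" for x
    using supp[OF that(1,2)] that(3) by (intro card_subset_eq) (auto simp: card_mono order_antisym)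
  show ?case
  proof (cases "w = {#}")
    case True
    then show ?thesis by (intro exI[of _ 0]) simp
  next
    case False
    show ?thesis
    proof (cases "v \<subseteq># w")
      case True
      then obtain x where x: "w = v + x" by (metis subset_mset.le_iff_add)
      have "x \<in> carrier B" using cancel_closed[OF v(1)] less.prems(1) x by simp
      moreover have "size x < size w" using x v(2) by (simp add: nonempty_has_size)
      moreover have "set_mset x \<subseteq> set_mset v" using x less.prems(2) by auto
      ultimately obtain j where "x = repeat_mset j v" using less.hyps by blast
      then show ?thesis using x by (intro exI[of _ "Suc j"]) simp
    next
      case nle: False
      define ratio where "ratio h = real (count w h) / real (count v h)" for h
      have "Min (ratio ` set_mset v) \<in> ratio ` set_mset v" using v(2) by (intro Min_in) auto
      then obtain g where g: "g \<in> set_mset v" "ratio g = Min (ratio ` set_mset v)" by auto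
      have Min: "ratio g \<le> ratio h" if "h \<in> set_mset v" for h
        unfolding g(2) using that by (intro Min_le) auto
      define p q where "p = count w g" and "q = count v g"
      have q: "0 < q" using g(1) by (simp add: q_def)
      have le: "p * count v h \<le> q * count w h" for h
      proof (cases "h \<in> set_mset v")
        case True
        then have "0 < count v h" by simp
        then have "real p * real (count v h) \<le> real q * real (count w h)"
          using Min[OF True] q by (simp add: ratio_def p_def q_def field_simps)
        then show ?thesis by (metis of_nat_le_iff of_nat_mult)
      next
        case False
        then show ?thesis by (simp add: not_in_iff)
      qed
      obtain h where h: "count w h < count v h"
        using nle unfolding subseteq_mset_def by (meson not_le)
      have "p < q"
      proof (rule ccontr)
        assume "\<not> p < q"
        then have "q * count v h \<le> p * count v h" by simp
        also note le[of h]
        finally show False using q h by simp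
      qed
      have "repeat_mset p v \<subseteq># repeat_mset q w"
        using le by (simp add: subseteq_mset_def)
      then obtain x where x: "repeat_mset q w = repeat_mset p v + x"
        by (metis subset_mset.le_iff_add)
      have xB: "x \<in> carrier B"
        using cancel_closed[OF repeat_closed[OF v(1)]] repeat_closed[OF less.prems(1)] x by metis
      have count_x: "count x h = q * count w h - p * count v h" for h
        using arg_cong[OF x, of "\<lambda>m. count m h"] by simp
      have "count x g = 0" by (simp add: count_x p_def q_def mult.commute)
      then have "g \<notin> set_mset x" by (simp add: not_in_iff)
      moreover have "set_mset x \<subseteq> set_mset v"
      proof
        fix h assume h: "h \<in> set_mset x"
        have "h \<in> set_mset w"
        proof (rule ccontr)
          assume "h \<notin> set_mset w"
          then have "count x h = 0" using count_x[of h] by (simp add: not_in_iff)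
          then show False using h by (metis not_in_iff)
        qed
        then show "h \<in> set_mset v" using less.prems(2) by auto
      qed
      ultimately have "x = {#}" using eq_supp[OF xB] g(1) by blast
      then have "q * size w = p * size v"
        using arg_cong[OF x, of size] by simp
      moreover have "0 < size v" using v(2) by (simp add: nonempty_has_size)
      ultimately have "q * size w < q * size v" using \<open>p < q\<close> by simp
      moreover have "size v \<le> size w"
        using size[OF less.prems(1) False] eq_supp[OF less.prems(1) False less.prems(2)] by blast
      ultimately show ?thesis by simp
    qed
  qed
qed

lemma minimal_support_exists:
  assumes "carrier B \<noteq> {{#}}"
  obtains v where "v \<in> carrier B" "v \<noteq> {#}"
    "\<And>w. w \<in> carrier B \<Longrightarrow> w \<noteq> {#} \<Longrightarrow> card (set_mset v) \<le> card (set_mset w)"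
    "\<And>w. w \<in> carrier B \<Longrightarrow> w \<noteq> {#} \<Longrightarrow> set_mset w = set_mset v \<Longrightarrow> size v \<le> size w"
proof -
  obtain x where x: "x \<in> carrier B \<and> x \<noteq> {#}" using assms empty_closed by blast
  obtain y where y: "y \<in> carrier B \<and> y \<noteq> {#}"
    "\<And>w. w \<in> carrier B \<and> w \<noteq> {#} \<Longrightarrow> card (set_mset y) \<le> card (set_mset w)"
    using ex_has_least_nat[of "\<lambda>w. w \<in> carrier B \<and> w \<noteq> {#}" x "\<lambda>w. card (set_mset w)"] x by blast
  obtain v where v: "v \<in> carrier B \<and> v \<noteq> {#} \<and> set_mset v = set_mset y"
    "\<And>w. w \<in> carrier B \<and> w \<noteq> {#} \<and> set_mset w = set_mset y \<Longrightarrow> size v \<le> size w"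
    using ex_has_least_nat[of "\<lambda>w. w \<in> carrier B \<and> w \<noteq> {#} \<and> set_mset w = set_mset y" y size] y(1)
    by blast
  show ?thesis
    by (rule that[of v]) (use v y(2) in auto)
qed

lemma singletons_in_system:
  assumes "carrier B \<noteq> {{#}}"
  shows "{k} \<in> system_of_lengths B"
proof -
  obtain v where v: "v \<in> carrier B" "v \<noteq> {#}"
    "\<And>w. w \<in> carrier B \<Longrightarrow> w \<noteq> {#} \<Longrightarrow> card (set_mset v) \<le> card (set_mset w)"
    "\<And>w. w \<in> carrier B \<Longrightarrow> w \<noteq> {#} \<Longrightarrow> set_mset w = set_mset v \<Longrightarrow> size v \<le> size w"
    using minimal_support_exists[OF assms] by blast
  have power: "\<exists>j. w = repeat_mset j v" if "w \<in> carrier B" "set_mset w \<subseteq> set_mset v" for w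
    by (rule minimal_support_powers[OF v that])
  have inj: "i = j" if "repeat_mset i v = repeat_mset j v" for i j
    using arg_cong[OF that, of size] v(2) by simp
  have vatom: "v \<in> atoms B"
    unfolding B.atoms_iff nonunits_def Units_B
  proof (intro conjI ballI impI)
    fix x y assume xy: "x \<in> carrier B" "y \<in> carrier B" "v = x \<otimes>\<^bsub>B\<^esub> y"
    have "set_mset x \<subseteq> set_mset v" "set_mset y \<subseteq> set_mset v" using xy(3) by auto
    then obtain i j where ij: "x = repeat_mset i v" "y = repeat_mset j v"
      using power[OF xy(1)] power[OF xy(2)] by auto
    then have "size v = (i + j) * size v"
      using arg_cong[OF xy(3), of size] by (simp add: add_mult_distrib)
    then have "i + j = 1" using v(2) by simp
    then have "i = 0 \<or> j = 0" by linarith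
    then show "x \<in> {{#}} \<or> y \<in> {{#}}" using ij by auto
  qed (use v in auto)
  have "has_length B (repeat_mset k v) k" for k
  proof (induction k)
    case 0
    then show ?case by (simp add: has_length.unit Units_B)
  next
    case (Suc k)
    then show ?case using has_length.atom[OF vatom Suc] by simp
  qed
  moreover have only: "x = repeat_mset l v" if "has_length B x l" "set_mset x \<subseteq> set_mset v" for x l
    using that
  proof induction
    case (unit x)
    then show ?case by (simp add: Units_B)
  next
    case (atom u x l)
    have u: "u \<in> carrier B" "u \<notin> Units B" by (rule atoms_closed[OF atom.hyps(1)], rule atoms_nonunit[OF atom.hyps(1)])
    obtain i where i: "u = repeat_mset i v" using power[OF u(1)] atom.prems by auto
    then obtain j where j: "i = Suc j" using u(2) by (cases i) (auto simp: Units_B)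
    have "u = v \<otimes>\<^bsub>B\<^esub> repeat_mset j v" using i j by simp
    then have "v \<in> Units B \<or> repeat_mset j v \<in> Units B"
      using atom.hyps(1) v(1) repeat_closed[OF v(1)] unfolding B.atoms_iff by blast
    then have "repeat_mset j v \<in> Units B" using atoms_nonunit[OF vatom] by blast
    then have "u = v" using i j by (simp add: Units_B)
    then show ?case using atom by simp
  qed
  moreover have "l = k" if "has_length B (repeat_mset k v) l" for l
  proof -
    have "set_mset (repeat_mset k v) \<subseteq> set_mset v" by (induction k) auto
    then show ?thesis using inj[OF only[OF that]] by simp
  qed
  ultimately have "{l. has_length B (repeat_mset k v) l} = {k}" by blast
  then show ?thesis
    using repeat_closed[OF v(1)] unfolding B.system_of_lengths_eq by blast
qed

end

theorem theorem5p6: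
  fixes n :: nat and D :: "nat \<Rightarrow> ('a, 'm) monoid_scheme"
  assumes "n \<ge> 1"
    and "\<And>i. i \<in> {1..n} \<Longrightarrow> strongly_primary (D i)"
    and "\<And>i. i \<in> {1..n} \<Longrightarrow> \<not> half_factorial (D i)"
  shows
    "(\<forall>L :: nat set. finite L \<and> L \<noteq> {} \<and> 0 \<notin> L \<longrightarrow>
        (\<exists>y\<^sub>L. \<forall>y\<ge>y\<^sub>L. (+) y ` L \<notin> system_of_lengths (product_group {1..n} D))) \<and>
     (\<forall>(G :: 'g monoid) G0. comm_group G \<and> G0 \<subseteq> carrier G \<longrightarrow>
        system_of_lengths (product_group {1..n} D) \<noteq> system_of_lengths (zero_sum_monoid G G0)) \<and>
     \<not> transfer_krull TYPE('g) (product_group {1..n} D) \<and>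
     ((\<forall>i\<in>{1..n}. locally_tame (D i)) \<longrightarrow> structure_theorem (product_group {1..n} D))"
proof -
  interpret comm_monoid_cancel_family "{1..n}" D
    using assms(2) by (intro comm_monoid_cancel_family.intro) (simp_all add: strongly_primary_def)
  have long: "long_progressions P"
    using assms strongly_primary_long_progressions by (intro product_long_progressions) auto
  have shift: "\<exists>y0. \<forall>y\<ge>y0. (+) y ` L \<notin> system_of_lengths P" if "finite L" "L \<noteq> {}" for L
    by (rule long_progressions_shift[OF long product_comm_monoid_cancel that])
  have nontrivial: "system_of_lengths P \<noteq> {{0}}"
  proof
    assume triv: "system_of_lengths P = {{0}}"
    have 1: "1 \<in> {1..n}" using assms(1) by simp
    obtain x where x: "x \<in> carrier (D 1)" "x \<notin> Units (D 1)"
      using assms(2)[OF 1] by (auto simp: strongly_primary_def nonunits_def)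
    have "{k. has_length P (single 1 x) k} \<in> system_of_lengths P"
      using single_closed[OF 1 x(1)] unfolding P.system_of_lengths_eq by blast
    then have "has_length P (single 1 x) 0" unfolding triv by blast
    then show False using single_Units_iff[OF 1 x(1)] x(2) P.has_length_0_iff by blast
  qed
  have distinct: "system_of_lengths P \<noteq> system_of_lengths (zero_sum_monoid G G0)"
    if G: "comm_group G" "G0 \<subseteq> carrier G" for G :: "'g monoid" and G0
  proof
    assume eq: "system_of_lengths P = system_of_lengths (zero_sum_monoid G G0)"
    interpret comm_group G by (rule G(1))
    interpret Z: zero_sum G G0 using G(2) by unfold_locales
    show False
    proof (cases "carrier Z.B = {{#}}")
      case True
      then have "system_of_lengths Z.B = {{0}}"
        unfolding system_of_lengths_def by (simp add: set_of_lengths_def Z.Units_B)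
      then show False using nontrivial eq by simp
    next
      case False
      obtain y where "(+) y ` {1} \<notin> system_of_lengths P"
        using shift[of "{1}"] by blast
      then show False using Z.singletons_in_system[OF False, of "y + 1"] eq by simp
    qed
  qed
  have not_krull: "\<not> transfer_krull TYPE('g) P"
  proof
    assume "transfer_krull TYPE('g) P"
    then obtain G :: "'g monoid" and G0 \<theta> where G: "comm_group G" "G0 \<subseteq> carrier G"
      and \<theta>: "weak_transfer_hom P (zero_sum_monoid G G0) \<theta>"
      unfolding transfer_krull_def by blast
    interpret comm_group G by (rule G(1))
    interpret Z: zero_sum G G0 using G(2) by unfold_locales
    have "Units Z.B = {\<one>\<^bsub>Z.B\<^esub>}" by (simp add: Z.Units_B)
    then have "system_of_lengths P = system_of_lengths Z.B"
      by (rule weak_transfer_hom_system[OF product_comm_monoid_cancel Z.comm_monoid_cancel_B Z.atomic_B _ \<theta>])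
    then show False using distinct[OF G] by simp
  qed
  have struct: "structure_theorem P" if tame: "\<forall>i\<in>{1..n}. locally_tame (D i)"
  proof -
    have "\<forall>i\<in>{1..n}. \<exists>d M. 0 < d \<and>
        (\<forall>a\<in>carrier (D i). central_periodic d M (int ` {k. has_length (D i) a k}))"
      using central_periodic_lengths assms(2,3) tame by blast
    then obtain d M where dM: "\<And>i. i \<in> {1..n} \<Longrightarrow> 0 < d i"
      "\<And>i a. i \<in> {1..n} \<Longrightarrow> a \<in> carrier (D i) \<Longrightarrow>
        central_periodic (d i) (M i) (int ` {k. has_length (D i) a k})"
      by metis
    define e where "e = prod d {1..n}"
    have e: "0 < e" using dM(1) by (simp add: e_def prod_pos)
    have factor: "central_periodic e (sum M {1..n}) (int ` {k. has_length (D i) a k})"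
      if "i \<in> {1..n}" "a \<in> carrier (D i)" for i a
      using that unfolding e_def
      by (intro central_periodic_mono[OF dM(2)] dvd_prodI member_le_sum) auto
    obtain N where N: "\<And>S. (\<forall>i\<in>{1..n}. finite (S i) \<and> S i \<noteq> {} \<and> central_periodic e (sum M {1..n}) (S i)) \<Longrightarrow>
        finite (sum_family {1..n} S) \<and> sum_family {1..n} S \<noteq> {} \<and> central_periodic e N (sum_family {1..n} S)"
      using central_periodic_sum_family[OF finite_index e] by blast
    have main: "finite {k. has_length P a k} \<and> {k. has_length P a k} \<noteq> {} \<and>
        central_periodic e N (int ` {k. has_length P a k})" if a: "a \<in> carrier P" for a
    proof -
      define S where "S i = int ` {k. has_length (D i) (a i) k}" for i
      have "finite (S i) \<and> S i \<noteq> {} \<and> central_periodic e (sum M {1..n}) (S i)" if i: "i \<in> {1..n}" for i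
        using strongly_primary_finite_lengths[OF assms(2)[OF i] factor_closed[OF i a]]
          strongly_primary_has_length[OF assms(2)[OF i] factor_closed[OF i a]]
          factor[OF i factor_closed[OF i a]]
        by (simp add: S_def)
      moreover have "int ` {k. has_length P a k} = sum_family {1..n} S"
      proof (intro equalityI subsetI)
        fix x assume "x \<in> int ` {k. has_length P a k}"
        then obtain f where f: "\<forall>i\<in>{1..n}. has_length (D i) (a i) (f i)" "x = int (sum f {1..n})"
          using has_length_coordinates by blast
        then show "x \<in> sum_family {1..n} S"
          unfolding sum_family_def S_def
          by (intro CollectI exI[of _ "\<lambda>i. int (f i)"]) simp
      next
        fix x assume "x \<in> sum_family {1..n} S"
        then obtain g where g: "\<forall>i\<in>{1..n}. g i \<in> S i" "x = sum g {1..n}"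
          unfolding sum_family_def by blast
        have f: "\<forall>i\<in>{1..n}. has_length (D i) (a i) (nat (g i)) \<and> int (nat (g i)) = g i"
          using g(1) by (auto simp: S_def)
        then have "has_length P a (\<Sum>i\<in>{1..n}. nat (g i))"
          unfolding has_length_product_iff[OF a]
          by (intro exI[of _ "\<lambda>i. nat (g i)"]) simp
        moreover have "x = int (\<Sum>i\<in>{1..n}. nat (g i))"
          using f g(2) by simp
        ultimately show "x \<in> int ` {k. has_length P a k}" by blast
      qed
      ultimately have "finite (int ` {k. has_length P a k})" "int ` {k. has_length P a k} \<noteq> {}"
        "central_periodic e N (int ` {k. has_length P a k})"
        using N[of S] by simp_all
      then show ?thesis by (simp add: finite_image_iff inj_on_def)
    qed
    have "atomic P" unfolding P.atomic_iff using main by blast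
    moreover have "\<exists>p. is_AAMP e p (2 * N + 2 * e) (int ` L)" if LP: "L \<in> system_of_lengths P" for L
    proof -
      obtain a where a: "a \<in> carrier P" and L: "L = {k. has_length P a k}"
        using LP unfolding P.system_of_lengths_eq by blast
      show ?thesis
        using main[OF a] unfolding L by (intro is_AAMP_of_central_periodic[OF e]) simp_all
    qed
    ultimately show ?thesis
      unfolding structure_theorem_def using e
      by (intro conjI exI[of _ "2 * N + 2 * e"] exI[of _ "{e}"]) auto
  qed
  show ?thesis
    using shift distinct not_krull struct by blast
qed

end
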